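(* In the free step-two group $N_{3,2}$ described in the context, let $x=|x|e_1$ with $|x|>0$ and let $\theta=(\theta_1,\theta_2,0)\in B_{\mathbb R^3}(0,\pi)$ with $\theta_2>0$. Put $$t=\frac{|x|^2}{4}\theta_2\Big[\frac{\psi'(|\theta|)}{|\theta|}\theta_2\,\theta+2\psi(|\theta|)e_2\Big].$$ Then $$d(x,t)^2=\phi((x,t);\theta)=|x|^2\big[1+\psi(|\theta|)\theta_2^2+\psi'(|\theta|)|\theta|\theta_2^2\big]=|x|^2\Big[\frac{\theta_1^2}{|\theta|^2}+\Big(\frac{\theta_2}{\sin|\theta|}\Big)^2\Big]=\Big|\frac{U(\theta)}{\sin U(\theta)}x\Big|^2.$$
   Context: $N_{3,2}$ is $\mathbb R^3\times\mathbb R^3$ with law $(x,t)\cdot(x',t')=(x+x',t+t'+\frac12\langle\mathbb Ux,x'\rangle)$, $\langle\mathbb Ux,x'\rangle=(\langle U^{(j)}x,x'\rangle)_{j=1}^3$, where $\sum_j\tau_jU^{(j)}=\begin{pmatrix}0&\tau_3&-\tau_2\\-\tau_3&0&\tau_1\\\tau_2&-\tau_1&0\end{pmatrix}$; identity $o$. $d(g)$ is the Carnot–Carathéodory distance from $o$ (infimum of $\int_0^1|x'|$ over absolutely continuous curves from $o$ to $g$ with $t'=\frac12\langle\mathbb Ux,x'\rangle$). $U(\tau)=i\sum_j\tau_jU^{(j)}$; $e_1,e_2,e_3$ standard basis. $\psi(s)=(1-s\cot s)/s^2$ ($\psi(0)=1/3$), and $\phi((x,t);\tau)=\langle U(\tau)\cot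 U(\tau)x,x\rangle+4t\cdot\tau=|x|^2|\tau|\cot|\tau|+\psi(|\tau|)\langle\tau,x\rangle^2+4t\cdot\tau$. *)

theory Defs
  imports "HOL-Analysis.Analysis"
begin

definition Uskew :: "real^3 \<Rightarrow> real^3^3" where
  "Uskew \<tau> = vector [vector [0, \<tau>$3, - \<tau>$2],
                      vector [- \<tau>$3, 0, \<tau>$1],
                      vector [\<tau>$2, - \<tau>$1, 0]]"

definition Ucoef :: "3 \<Rightarrow> real^3^3" where
  "Ucoef j = Uskew (axis j 1)"

definition Ubr :: "real^3 \<Rightarrow> real^3 \<Rightarrow> real^3" where
  "Ubr x x' = (\<chi> j. (Ucoef j *v x) \<bullet> x')"

definition Nmult :: "((real^3) \<times> (real^3)) \<Rightarrow> ((real^3) \<times> (real^3)) \<Rightarrow> ((real^3) \<times> (real^3))" where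
  "Nmult g h = (fst g + fst h, snd g + snd h + (1/2) *\<^sub>R Ubr (fst g) (fst h))"

definition Nid :: "(real^3) \<times> (real^3)" where
  "Nid = (0, 0)"

definition abs_cont_on :: "real \<Rightarrow> real \<Rightarrow> (real \<Rightarrow> 'a::real_normed_vector) \<Rightarrow> bool" where
  "abs_cont_on a b f \<longleftrightarrow>
     (\<forall>\<epsilon>>0. \<exists>\<delta>>0. \<forall>(n::nat) (I::nat \<Rightarrow> real \<times> real).
        (\<forall>i<n. a \<le> fst (I i) \<and> fst (I i) \<le> snd (I i) \<and> snd (I i) \<le> b) \<and>
        (\<forall>i<n. \<forall>j<n. i \<noteq> j \<longrightarrow> snd (I i) \<le> fst (I j) \<or> snd (I j) \<le> fst (I i)) \<and>
        (\<Sum>i<n. snd (I i) - fst (I i)) < \<delta>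
        \<longrightarrow> (\<Sum>i<n. norm (f (snd (I i)) - f (fst (I i)))) < \<epsilon>)"

definition horizontal_curve :: "(real \<Rightarrow> (real^3) \<times> (real^3)) \<Rightarrow> (real^3) \<times> (real^3) \<Rightarrow> bool" where
  "horizontal_curve \<gamma> g \<longleftrightarrow>
     abs_cont_on 0 1 \<gamma> \<and> \<gamma> 0 = Nid \<and> \<gamma> 1 = g \<and>
     (AE s in lborel. s \<in> {0..1} \<longrightarrow>
        \<gamma> differentiable (at s) \<and>
        snd (vector_derivative \<gamma> (at s)) =
          (1/2) *\<^sub>R Ubr (fst (\<gamma> s)) (fst (vector_derivative \<gamma> (at s))))"

definition horiz_length :: "(real \<Rightarrow> (real^3) \<times> (real^3)) \<Rightarrow> real" where
  "horiz_length \<gamma> = (LINT s:{0..1}|lborel. norm (fst (vector_derivative \<gamma> (at s))))"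

definition ccdist :: "(real^3) \<times> (real^3) \<Rightarrow> real" where
  "ccdist g = Inf {horiz_length \<gamma> | \<gamma>. horizontal_curve \<gamma> g}"

definition Umat :: "real^3 \<Rightarrow> complex^3^3" where
  "Umat \<tau> = (\<chi> i j. \<i> * complex_of_real (Uskew \<tau> $ i $ j))"

text \<open>Functional calculus for diagonalisable (e.g. Hermitian) matrices:
  f(H) acts as f(lambda) on every eigenvector with eigenvalue lambda.\<close>
definition matfun :: "(complex \<Rightarrow> complex) \<Rightarrow> complex^3^3 \<Rightarrow> complex^3^3" where
  "matfun f H = (THE M. \<forall>c v. H *v v = c *s v \<longrightarrow> M *v v = f c *s v)"

definition sdivsin :: "complex \<Rightarrow> complex" where
  "sdivsin z = (if z = 0 then 1 else z / sin z)"

definition scot :: "real \<Rightarrow> real" where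
  "scot s = (if s = 0 then 1 else s * cot s)"

definition psi :: "real \<Rightarrow> real" where
  "psi s = (if s = 0 then 1/3 else (1 - s * cot s) / s\<^sup>2)"

definition phi :: "(real^3) \<times> (real^3) \<Rightarrow> real^3 \<Rightarrow> real" where
  "phi g \<tau> = (norm (fst g))\<^sup>2 * scot (norm \<tau>) + psi (norm \<tau>) * (\<tau> \<bullet> fst g)\<^sup>2
              + 4 * (snd g \<bullet> \<tau>)"

end

theory Submission
  imports Defs
begin

text \<open>Upper bound: the helix around the axis \<open>\<theta>\<close> that solves the Hamiltonian equations with covector \<open>\<theta>\<close>
  joins the identity to \<open>(x, t)\<close> with constant speed.

  Lower bound: let \<open>M(s)\<close> be the solution of the matrix Riccati equation \<open>M' = - M\<^sup>2 - A\<^sup>T A\<close>, where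
  \<open>A x = x \<times> \<theta>\<close>, that blows up at \<open>s = -\<epsilon>\<close>; it acts as \<open>1/(s + \<epsilon>)\<close> along \<open>\<theta>\<close> and as
  \<open>|\<theta>| cot (|\<theta>| (s + \<epsilon>))\<close> on the orthogonal complement, and is finite on \<open>[0, 1]\<close> because \<open>|\<theta>| < \<pi>\<close>.
  Along a horizontal curve of length \<open>L\<close>, parametrised by arc length divided by \<open>L\<close>, the quantity
  \<open>\<langle>M(s) x, x\<rangle> + 4 \<theta> \<cdot> t - L\<^sup>2 s\<close> has derivative
  \<open>- |M x + A x|\<^sup>2 + 2 \<langle>M x + A x, x'\<rangle> - L\<^sup>2 = - |M x + A x - x'|\<^sup>2 \<le> 0\<close>.
  Comparing the endpoints and letting \<open>\<epsilon>\<close> tend to 0 gives \<open>\<phi>((x, t); \<theta>) \<le> L\<^sup>2\<close>. Curves are only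
  absolutely continuous and not reparametrised, so monotonicity is derived from increments, with errors
  quadratic in the arc length.\<close>

section \<open>Absolutely continuous curves\<close>

text \<open>Transfers the definition from lists of endpoint pairs to finite families of closed
  intervals with an arbitrary index type. The index is a tagged interval, an interval or the unit
  value in the later uses, so that Henstock-Kurzweil divisions can be fed in directly.\<close>

lemma abs_cont_on_intervals:
  assumes ac: "abs_cont_on a b f" and "e > 0"
  shows "\<exists>d>0. \<forall>T K. finite T \<longrightarrow> (\<forall>i\<in>T. \<exists>u v. u \<le> v \<and> K i = {u..v} \<and> a \<le> u \<and> v \<le> b) \<longrightarrow>
        (\<forall>i\<in>T. \<forall>j\<in>T. i \<noteq> j \<longrightarrow> interior (K i) \<inter> interior (K j) = {}) \<longrightarrow>
        (\<Sum>i\<in>T. measure lborel (K i)) < d \<longrightarrow>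
        (\<Sum>(i::'i)\<in>T. norm (f (Sup (K i)) - f (Inf (K i)))) < e"
proof -
  obtain d where "d > 0" and d: "\<forall>(n::nat) (I::nat \<Rightarrow> real \<times> real).
        (\<forall>i<n. a \<le> fst (I i) \<and> fst (I i) \<le> snd (I i) \<and> snd (I i) \<le> b) \<and>
        (\<forall>i<n. \<forall>j<n. i \<noteq> j \<longrightarrow> snd (I i) \<le> fst (I j) \<or> snd (I j) \<le> fst (I i)) \<and>
        (\<Sum>i<n. snd (I i) - fst (I i)) < d
        \<longrightarrow> (\<Sum>i<n. norm (f (snd (I i)) - f (fst (I i)))) < e"
    using ac[unfolded abs_cont_on_def, rule_format, OF \<open>e > 0\<close>] by (elim exE conjE)
  show ?thesis
  proof (intro exI[of _ d] conjI \<open>d > 0\<close> allI impI)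
    fix T :: "'i set" and K
    assume T: "finite T" and K': "\<forall>i\<in>T. \<exists>u v. u \<le> v \<and> K i = {u..v} \<and> a \<le> u \<and> v \<le> b"
      and disj: "\<forall>i\<in>T. \<forall>j\<in>T. i \<noteq> j \<longrightarrow> interior (K i) \<inter> interior (K j) = {}"
      and small: "(\<Sum>i\<in>T. measure lborel (K i)) < d"
    note K = K'[rule_format]
    \<comment> \<open>Disjointness of interiors says nothing about one-point intervals, which may
      lie inside another interval and violate the ordering in the definition. They contribute 0 to
      both sums, so only the nondegenerate intervals are enumerated.\<close>
    define S where "S = {i\<in>T. Inf (K i) < Sup (K i)}"
    have S: "finite S" "S \<subseteq> T" using T by (auto simp: S_def)
    have eqS: "Inf (K i) = Sup (K i)" if "i \<in> T - S" for i
    proof -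
      have "i \<in> T" using that by simp
      from K[OF this] obtain u v where "u \<le> v" "K i = {u..v}" by (elim exE conjE)
      then show ?thesis using that by (auto simp: S_def)
    qed
    have cont: "measure lborel (K i) = Sup (K i) - Inf (K i)" if "i \<in> T" for i
      using K[OF that] by auto
    obtain h where h: "bij_betw h {..<card S} S"
      using ex_bij_betw_nat_finite[OF S(1)] by (auto simp: atLeast0LessThan)
    define I where "I = (\<lambda>n. (Inf (K (h n)), Sup (K (h n))))"
    have hS: "h n \<in> S" if "n < card S" for n
      using h that by (auto simp: bij_betw_def)
    have hinj: "h m \<noteq> h n" if "m < card S" "n < card S" "m \<noteq> n" for m n
      using h that by (auto simp: bij_betw_def inj_on_def)
    have sep: "Sup (K i) \<le> Inf (K j) \<or> Sup (K j) \<le> Inf (K i)"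
      if ij: "i \<in> S" "j \<in> S" "i \<noteq> j" for i j
    proof (rule ccontr)
      assume neg: "\<not> ?thesis"
      obtain u v where uv: "u < v" "K i = {u..v}"
        using K[of i] ij by (auto simp: S_def)
      obtain u' v' where uv': "u' < v'" "K j = {u'..v'}"
        using K[of j] ij by (auto simp: S_def)
      have "max u u' < min v v'" using neg uv uv' by (auto simp: not_le)
      then obtain z where "max u u' < z" "z < min v v'" using dense by blast
      then have "z \<in> interior (K i) \<inter> interior (K j)" using uv uv' by auto
      then show False using disj ij S by blast
    qed
    have "(\<Sum>i<card S. norm (f (snd (I i)) - f (fst (I i)))) < e"
    proof (rule d[rule_format], intro conjI)
      show "\<forall>i<card S. a \<le> fst (I i) \<and> fst (I i) \<le> snd (I i) \<and> snd (I i) \<le> b"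
      proof (intro allI impI)
        fix i assume "i < card S"
        then have "h i \<in> T" using hS S by auto
        from K[OF this] obtain u v where "u \<le> v" "K (h i) = {u..v}" "a \<le> u" "v \<le> b"
          by (elim exE conjE)
        then show "a \<le> fst (I i) \<and> fst (I i) \<le> snd (I i) \<and> snd (I i) \<le> b"
          by (simp add: I_def)
      qed
      show "\<forall>i<card S. \<forall>j<card S. i \<noteq> j \<longrightarrow> snd (I i) \<le> fst (I j) \<or> snd (I j) \<le> fst (I i)"
        using sep hS hinj by (simp add: I_def)
      have "(\<Sum>i<card S. snd (I i) - fst (I i)) = (\<Sum>i\<in>S. Sup (K i) - Inf (K i))"
        unfolding I_def using sum.reindex_bij_betw[OF h, of "\<lambda>i. Sup (K i) - Inf (K i)"] by simp
      also have "\<dots> = (\<Sum>i\<in>S. measure lborel (K i))"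
        using cont S by (intro sum.cong) auto
      also have "\<dots> \<le> (\<Sum>i\<in>T. measure lborel (K i))"
        using T S by (intro sum_mono2) auto
      finally show "(\<Sum>i<card S. snd (I i) - fst (I i)) < d" using small by linarith
    qed
    also have "(\<Sum>i<card S. norm (f (snd (I i)) - f (fst (I i))))
        = (\<Sum>i\<in>S. norm (f (Sup (K i)) - f (Inf (K i))))"
      unfolding I_def
      using sum.reindex_bij_betw[OF h, of "\<lambda>i. norm (f (Sup (K i)) - f (Inf (K i)))"] by simp
    also have "\<dots> = (\<Sum>i\<in>T. norm (f (Sup (K i)) - f (Inf (K i))))"
      using T S eqS by (intro sum.mono_neutral_left) auto
    finally show "(\<Sum>i\<in>T. norm (f (Sup (K i)) - f (Inf (K i)))) < e" .
  qed
qed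

text \<open>Passing to interiors changes no length and makes the family pairwise disjoint, so the
  sum of lengths is the measure of a subset of \<open>U\<close>.\<close>

lemma sum_content_le_measure:
  assumes "finite T" and K: "\<And>i. i \<in> T \<Longrightarrow> \<exists>u v. u \<le> v \<and> K i = {u..v::real}"
    and disj: "\<And>i j. i \<in> T \<Longrightarrow> j \<in> T \<Longrightarrow> i \<noteq> j \<Longrightarrow> interior (K i) \<inter> interior (K j) = {}"
    and U: "U \<in> lmeasurable" "\<And>i. i \<in> T \<Longrightarrow> K i \<subseteq> U"
  shows "(\<Sum>i\<in>T. measure lborel (K i)) \<le> measure lebesgue U"
proof -
  have eq: "measure lborel (K i) = measure lebesgue (interior (K i))"
    and lm: "interior (K i) \<in> lmeasurable" if "i \<in> T" for i
    using K[OF that] by (auto simp: lmeasurable_interval)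
  have "(\<Sum>i\<in>T. measure lborel (K i)) = (\<Sum>i\<in>T. measure lebesgue (interior (K i)))"
    using eq by simp
  also have "\<dots> = measure lebesgue (\<Union>i\<in>T. interior (K i))"
    using \<open>finite T\<close> lm disj
    by (intro measure_UNION'[symmetric]) (auto simp: pairwise_def disjnt_def)
  also have "\<dots> \<le> measure lebesgue U"
  proof (rule measure_mono_fmeasurable[OF _ _ U(1)])
    show "(\<Union>i\<in>T. interior (K i)) \<subseteq> U"
      using U(2) interior_subset by blast
    show "(\<Union>i\<in>T. interior (K i)) \<in> sets lebesgue"
      using \<open>finite T\<close> lm by (intro sets.finite_UN) auto
  qed
  finally show ?thesis .
qed

lemma tagged_division_interval_facts:
  assumes "p tagged_division_of {a..b::real}" "i \<in> p"
  shows "\<exists>u v. u \<le> v \<and> snd i = {u..v} \<and> a \<le> u \<and> v \<le> b"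
    "j \<in> p \<Longrightarrow> i \<noteq> j \<Longrightarrow> interior (snd i) \<inter> interior (snd j) = {}"
proof -
  obtain x k where i: "i = (x, k)" by force
  have "x \<in> k" "k \<subseteq> {a..b}" "\<exists>u v. k = cbox u v"
    using tagged_division_ofD(2-4)[OF assms(1), of x k] assms(2) i by auto
  then obtain u v where "k = {u..v}" "u \<le> v" "{u..v} \<subseteq> {a..b}" by auto
  then show "\<exists>u v. u \<le> v \<and> snd i = {u..v} \<and> a \<le> u \<and> v \<le> b" using i by auto
next
  assume "j \<in> p" "i \<noteq> j"
  then show "interior (snd i) \<inter> interior (snd j) = {}"
    using tagged_division_ofD(5)[OF assms(1), of "fst i" "snd i" "fst j" "snd j"] assms(2)
    by (cases i; cases j) auto
qed

text \<open>Tags in the exceptional null set are handled by absolute continuity: their intervals lie in an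
  open set of small measure.\<close>

theorem fundamental_theorem_of_calculus_abs_cont:
  fixes f :: "real \<Rightarrow> 'a::banach"
  assumes "a \<le> b" and ac: "abs_cont_on a b f" and N: "negligible N"
    and der: "\<And>x. x \<in> {a..b} - N \<Longrightarrow> (f has_vector_derivative f' x) (at x within {a..b})"
  shows "(f' has_integral (f b - f a)) {a..b}"
proof -
  \<comment> \<open>At a tag in \<open>N\<close> the value 0 reduces the error term of the Riemann
    sum to a bare increment of \<open>f\<close>, which absolute continuity controls. The change on a
    negligible set is undone at the very end.\<close>
  define g where "g = (\<lambda>x. if x \<in> N then 0 else f' x)"
  have "(g has_integral (f b - f a)) (cbox a b)"
    unfolding has_integral
  proof (intro allI impI)
    fix e :: real assume "e > 0"
    \<comment> \<open>Intervals with a tag outside \<open>N\<close> cost at most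
      \<open>c * (b - a)\<close>, hence at most half of \<open>e\<close>; the added 1 covers the
      case \<open>a = b\<close>.\<close>
    define c where "c = e / (2 * (b - a + 1))"
    have "c > 0" using \<open>e > 0\<close> \<open>a \<le> b\<close> by (simp add: c_def)
    obtain d where "d > 0" and d: "\<forall>T K. finite T \<longrightarrow>
        (\<forall>i\<in>T. \<exists>u v. u \<le> v \<and> K i = {u..v} \<and> a \<le> u \<and> v \<le> b) \<longrightarrow>
        (\<forall>i\<in>T. \<forall>j\<in>T. i \<noteq> j \<longrightarrow> interior (K i) \<inter> interior (K j) = {}) \<longrightarrow>
        (\<Sum>i\<in>T. measure lborel (K i)) < d \<longrightarrow>
        (\<Sum>(i::real \<times> real set)\<in>T. norm (f (Sup (K i)) - f (Inf (K i)))) < e / 2"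
      using abs_cont_on_intervals[OF ac half_gt_zero[OF \<open>e > 0\<close>], where 'i="real \<times> real set"]
      by (elim exE conjE)
    have Nsets: "N \<in> sets lebesgue" using N by (simp add: negligible_imp_sets)
    obtain U where U: "open U" "N \<subseteq> U" "U - N \<in> lmeasurable" "emeasure lebesgue (U - N) < ennreal d"
      using sets_lebesgue_outer_open[OF Nsets \<open>d > 0\<close>] by blast
    have "measure lebesgue (U - N) < d"
      using U(3,4) \<open>d > 0\<close> by (simp add: emeasure_eq_measure2 ennreal_less_iff)
    moreover have UN: "U = (U - N) \<union> N" using U(2) by auto
    moreover have Ulm: "U \<in> lmeasurable"
      using U(3) N UN by (metis fmeasurable.Un negligible_imp_measurable)
    ultimately have Um: "measure lebesgue U < d"
      using measure_Un_null_set[OF fmeasurableD[OF U(3)]] N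
      by (metis negligible_iff_null_sets)
    have "\<exists>r>0. (x \<in> N \<longrightarrow> ball x r \<subseteq> U) \<and> (x \<in> {a..b} - N \<longrightarrow>
        (\<forall>y\<in>{a..b}. norm (y - x) < r \<longrightarrow> norm (f y - f x - (y - x) *\<^sub>R f' x) \<le> c * norm (y - x)))" for x
    proof (cases "x \<in> {a..b} - N")
      case True
      have "\<forall>e>0. \<exists>r>0. \<forall>y\<in>{a..b}. norm (y - x) < r \<longrightarrow>
          norm (f y - f x - (y - x) *\<^sub>R f' x) \<le> e * norm (y - x)"
        using der[OF True] unfolding has_vector_derivative_def has_derivative_within_alt by blast
      then obtain r where "r > 0" "\<forall>y\<in>{a..b}. norm (y - x) < r \<longrightarrow>
          norm (f y - f x - (y - x) *\<^sub>R f' x) \<le> c * norm (y - x)"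
        using \<open>c > 0\<close> by blast
      then show ?thesis using True by (intro exI[of _ r]) auto
    next
      case False
      show ?thesis
      proof (cases "x \<in> N")
        case True
        then obtain r where "r > 0" "ball x r \<subseteq> U"
          using U(1,2) open_contains_ball by blast
        then show ?thesis using True by (intro exI[of _ r]) auto
      next
        case False
        then show ?thesis using \<open>x \<notin> {a..b} - N\<close> by (intro exI[of _ 1]) auto
      qed
    qed
    then obtain r where r: "\<And>x. r x > 0" "\<And>x. x \<in> N \<Longrightarrow> ball x (r x) \<subseteq> U"
      "\<And>x y. x \<in> {a..b} - N \<Longrightarrow> y \<in> {a..b} \<Longrightarrow> norm (y - x) < r x \<Longrightarrow>
        norm (f y - f x - (y - x) *\<^sub>R f' x) \<le> c * norm (y - x)"
      using choice[of "\<lambda>x r. r > 0 \<and> (x \<in> N \<longrightarrow> ball x r \<subseteq> U) \<and> (x \<in> {a..b} - N \<longrightarrow>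
        (\<forall>y\<in>{a..b}. norm (y - x) < r \<longrightarrow> norm (f y - f x - (y - x) *\<^sub>R f' x) \<le> c * norm (y - x)))"]
      by blast
    show "\<exists>\<gamma>. gauge \<gamma> \<and> (\<forall>p. p tagged_division_of cbox a b \<and> \<gamma> fine p \<longrightarrow>
            norm ((\<Sum>(x, k)\<in>p. measure lborel k *\<^sub>R g x) - (f b - f a)) < e)"
    proof (intro exI[of _ "\<lambda>x. ball x (r x)"] conjI allI impI)
      show "gauge (\<lambda>x. ball x (r x))" using r(1) by (simp add: gauge_def)
      fix p assume p: "p tagged_division_of cbox a b \<and> (\<lambda>x. ball x (r x)) fine p"
      then have p1: "p tagged_division_of {a..b}" and fine: "(\<lambda>x. ball x (r x)) fine p" by auto
      have fin: "finite p" using p1 by blast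
      \<comment> \<open>The error of a single tagged interval. The increments of \<open>f\<close>
        telescope over a division, so \<open>sum h p\<close> is the whole error of the Riemann
        sum.\<close>
      define h where "h = (\<lambda>i. measure lborel (snd i) *\<^sub>R g (fst i) - (f (Sup (snd i)) - f (Inf (snd i))))"
      define P where "P = {i\<in>p. fst i \<in> N}"
      have P: "P \<subseteq> p" "finite P" using fin by (auto simp: P_def)
      have bnd: "norm (h i) \<le> c * measure lborel (snd i)" if i: "i \<in> p - P" for i
      proof -
        obtain x k where ik: "i = (x, k)" by force
        obtain u v where uv: "u \<le> v" "k = {u..v}" "a \<le> u" "v \<le> b"
          using tagged_division_interval_facts(1)[OF p1, of i] i ik by auto
        have xk: "x \<in> {u..v}" using tagged_division_ofD(2)[OF p1, of x k] i ik uv by simp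
        have "k \<subseteq> ball x (r x)" using fine i ik by (auto simp: fine_def)
        then have near: "norm (v - x) < r x" "norm (u - x) < r x"
          using uv by (auto simp: dist_norm norm_minus_commute subset_iff)
        have x: "x \<in> {a..b} - N" using i ik xk uv by (auto simp: P_def)
        \<comment> \<open>Both endpoints are compared with the tag \<open>x\<close>. Since
          \<open>x\<close> lies between \<open>u\<close> and \<open>v\<close>, the two distances add
          up to the length of the interval, so the linear errors add up to \<open>c\<close> times
          that length.\<close>
        have h: "h i = (f u - f x - (u - x) *\<^sub>R f' x) - (f v - f x - (v - x) *\<^sub>R f' x)"
          using ik uv x by (simp add: h_def g_def algebra_simps)
        have "norm (h i) \<le> c * norm (u - x) + c * norm (v - x)"
          unfolding h
        proof (rule order.trans[OF norm_triangle_ineq4 add_mono])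
          show "norm (f u - f x - (u - x) *\<^sub>R f' x) \<le> c * norm (u - x)"
            using r(3)[OF x _ near(2)] uv by auto
          show "norm (f v - f x - (v - x) *\<^sub>R f' x) \<le> c * norm (v - x)"
            using r(3)[OF x _ near(1)] uv by auto
        qed
        also have "\<dots> = c * measure lborel (snd i)"
          using ik uv xk by (simp add: algebra_simps)
        finally show ?thesis .
      qed
      have sumP: "norm (sum h P) < e / 2"
      proof -
        have facts: "\<exists>u v. u \<le> v \<and> snd i = {u..v} \<and> a \<le> u \<and> v \<le> b"
          "j \<in> P \<Longrightarrow> i \<noteq> j \<Longrightarrow> interior (snd i) \<inter> interior (snd j) = {}" if "i \<in> P" for i j
          using tagged_division_interval_facts[OF p1, of i] that P(1) by blast+
        have "norm (sum h P) \<le> (\<Sum>i\<in>P. norm (f (Sup (snd i)) - f (Inf (snd i))))"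
          by (rule sum_norm_le) (simp add: h_def g_def P_def norm_minus_commute)
        also have "\<dots> < e / 2"
        proof (rule d[rule_format, OF P(2)])
          have "(\<Sum>i\<in>P. measure lborel (snd i)) \<le> measure lebesgue U"
          proof (rule sum_content_le_measure[OF P(2) _ _ Ulm])
            fix i assume i: "i \<in> P"
            then have "snd i \<subseteq> ball (fst i) (r (fst i))" using fine P(1)
              by (cases i) (auto simp: fine_def)
            then show "snd i \<subseteq> U" using r(2) i by (auto simp: P_def)
          qed (use facts(2) in \<open>auto dest: facts(1)\<close>)
          then show "(\<Sum>i\<in>P. measure lborel (snd i)) < d" using Um by linarith
        qed (use facts in auto)
        finally show ?thesis .
      qed
      have "norm (sum h (p - P)) \<le> (\<Sum>i\<in>p-P. c * measure lborel (snd i))"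
        using bnd by (rule sum_norm_le)
      also have "\<dots> \<le> (\<Sum>i\<in>p. c * measure lborel (snd i))"
        using fin \<open>c > 0\<close> by (intro sum_mono2) auto
      also have "\<dots> = c * (b - a)"
        using additive_content_tagged_division[of p a b] p1 \<open>a \<le> b\<close>
        by (simp add: sum_distrib_left[symmetric] case_prod_unfold)
      also have "\<dots> \<le> e / 2"
        using \<open>e > 0\<close> \<open>a \<le> b\<close> by (simp add: c_def field_simps)
      finally have "norm (sum h (p - P)) \<le> e / 2" .
      moreover have "sum h p = sum h (p - P) + sum h P"
        using sum.subset_diff[OF P(1) fin] .
      ultimately have "norm (sum h p) < e"
        using sumP norm_triangle_ineq[of "sum h (p - P)" "sum h P"] by auto
      moreover have "sum h p = (\<Sum>(x, k)\<in>p. measure lborel k *\<^sub>R g x) - (f b - f a)"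
        using additive_tagged_division_1[OF \<open>a \<le> b\<close> p1, of f]
        by (simp add: h_def sum_subtractf case_prod_unfold)
      ultimately show "norm ((\<Sum>(x, k)\<in>p. measure lborel k *\<^sub>R g x) - (f b - f a)) < e" by simp
    qed
  qed
  then show ?thesis
    using has_integral_spike[OF N, of "{a..b}" f' g] by (auto simp: g_def)
qed

lemma abs_cont_on_subinterval:
  assumes "abs_cont_on a b f" "a \<le> c" "d \<le> b"
  shows "abs_cont_on c d f"
  unfolding abs_cont_on_def
proof (intro allI impI)
  fix e :: real assume "e > 0"
  from assms(1)[unfolded abs_cont_on_def, rule_format, OF this]
  obtain r where "r > 0" and r: "\<forall>(n::nat) (I::nat \<Rightarrow> real \<times> real).
        (\<forall>i<n. a \<le> fst (I i) \<and> fst (I i) \<le> snd (I i) \<and> snd (I i) \<le> b) \<and>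
        (\<forall>i<n. \<forall>j<n. i \<noteq> j \<longrightarrow> snd (I i) \<le> fst (I j) \<or> snd (I j) \<le> fst (I i)) \<and>
        (\<Sum>i<n. snd (I i) - fst (I i)) < r
        \<longrightarrow> (\<Sum>i<n. norm (f (snd (I i)) - f (fst (I i)))) < e"
    by (elim exE conjE)
  show "\<exists>r>0. \<forall>(n::nat) (I::nat \<Rightarrow> real \<times> real).
        (\<forall>i<n. c \<le> fst (I i) \<and> fst (I i) \<le> snd (I i) \<and> snd (I i) \<le> d) \<and>
        (\<forall>i<n. \<forall>j<n. i \<noteq> j \<longrightarrow> snd (I i) \<le> fst (I j) \<or> snd (I j) \<le> fst (I i)) \<and>
        (\<Sum>i<n. snd (I i) - fst (I i)) < r
        \<longrightarrow> (\<Sum>i<n. norm (f (snd (I i)) - f (fst (I i)))) < e"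
  proof (intro exI[of _ r] conjI allI impI \<open>r > 0\<close>)
    fix n :: nat and I :: "nat \<Rightarrow> real \<times> real"
    assume I: "(\<forall>i<n. c \<le> fst (I i) \<and> fst (I i) \<le> snd (I i) \<and> snd (I i) \<le> d) \<and>
        (\<forall>i<n. \<forall>j<n. i \<noteq> j \<longrightarrow> snd (I i) \<le> fst (I j) \<or> snd (I j) \<le> fst (I i)) \<and>
        (\<Sum>i<n. snd (I i) - fst (I i)) < r"
    show "(\<Sum>i<n. norm (f (snd (I i)) - f (fst (I i)))) < e"
    proof (rule r[rule_format], intro conjI)
      show "\<forall>i<n. a \<le> fst (I i) \<and> fst (I i) \<le> snd (I i) \<and> snd (I i) \<le> b"
        using I assms(2,3) by (meson order.trans)
    qed (use I in blast)+
  qed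
qed

lemma abs_cont_on_imp_continuous_on:
  assumes "abs_cont_on a b f"
  shows "continuous_on {a..b} f"
  unfolding continuous_on_iff
proof (intro ballI allI impI)
  fix x and e :: real assume x: "x \<in> {a..b}" and "e > 0"
  obtain d where "d > 0" and d: "\<forall>T K. finite T \<longrightarrow>
        (\<forall>i\<in>T. \<exists>u v. u \<le> v \<and> K i = {u..v} \<and> a \<le> u \<and> v \<le> b) \<longrightarrow>
        (\<forall>i\<in>T. \<forall>j\<in>T. i \<noteq> j \<longrightarrow> interior (K i) \<inter> interior (K j) = {}) \<longrightarrow>
        (\<Sum>i\<in>T. measure lborel (K i)) < d \<longrightarrow>
        (\<Sum>(i::unit)\<in>T. norm (f (Sup (K i)) - f (Inf (K i)))) < e"
    using abs_cont_on_intervals[OF assms \<open>e > 0\<close>, where 'i=unit] by (elim exE conjE)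
  show "\<exists>d>0. \<forall>x'\<in>{a..b}. dist x' x < d \<longrightarrow> dist (f x') (f x) < e"
  proof (intro exI[of _ d] conjI ballI impI \<open>d > 0\<close>)
    fix y assume y: "y \<in> {a..b}" "dist y x < d"
    have "(\<Sum>(i::unit)\<in>{()}. norm (f (Sup {min x y..max x y}) - f (Inf {min x y..max x y}))) < e"
    proof (rule d[rule_format, where K = "\<lambda>_. {min x y..max x y}"])
      show "\<exists>u v. u \<le> v \<and> {min x y..max x y} = {u..v} \<and> a \<le> u \<and> v \<le> b"
        using x y by (intro exI[of _ "min x y"] exI[of _ "max x y"]) auto
    qed (use y in \<open>auto simp: dist_real_def\<close>)
    then show "dist (f y) (f x) < e"
      by (auto simp: dist_norm min_def max_def norm_minus_commute split: if_splits)
  qed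
qed

text \<open>On an interval shorter than the \<open>d\<close> that belongs to error 1, the variation
  of \<open>f\<close> is at most 1. By the fundamental theorem that variation is the sum of the
  norms of the integrals of \<open>f'\<close> over a division, so the bounded variation criterion
  applies; finitely many such intervals are then glued together.\<close>

lemma abs_cont_on_derivative_absolutely_integrable:
  fixes f :: "real \<Rightarrow> 'a::euclidean_space"
  assumes "a \<le> b" and ac: "abs_cont_on a b f" and N: "negligible N"
    and der: "\<And>x. x \<in> {a..b} - N \<Longrightarrow> (f has_vector_derivative f' x) (at x)"
  shows "f' absolutely_integrable_on {a..b}"
proof -
  have ftc: "(f' has_integral (f v - f u)) {u..v}" if "a \<le> u" "u \<le> v" "v \<le> b" for u v
  proof (rule fundamental_theorem_of_calculus_abs_cont[OF \<open>u \<le> v\<close> _ N])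
    show "abs_cont_on u v f" using abs_cont_on_subinterval[OF ac] that by blast
    show "(f has_vector_derivative f' x) (at x within {u..v})" if "x \<in> {u..v} - N" for x
      using der[of x] that \<open>a \<le> u\<close> \<open>v \<le> b\<close> by (auto intro: has_vector_derivative_at_within)
  qed
  obtain d where "d > 0" and d: "\<forall>T K. finite T \<longrightarrow>
        (\<forall>i\<in>T. \<exists>u v. u \<le> v \<and> K i = {u..v} \<and> a \<le> u \<and> v \<le> b) \<longrightarrow>
        (\<forall>i\<in>T. \<forall>j\<in>T. i \<noteq> j \<longrightarrow> interior (K i) \<inter> interior (K j) = {}) \<longrightarrow>
        (\<Sum>i\<in>T. measure lborel (K i)) < d \<longrightarrow>
        (\<Sum>(i::real set)\<in>T. norm (f (Sup (K i)) - f (Inf (K i)))) < 1"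
    using abs_cont_on_intervals[OF ac zero_less_one, where 'i="real set"] by (elim exE conjE)
  have short: "f' absolutely_integrable_on {u..v}"
    if uv: "a \<le> u" "u \<le> v" "v \<le> b" "v - u < d" for u v
  proof -
    have "f' absolutely_integrable_on cbox u v"
    proof (rule bounded_variation_absolutely_integrable_interval[where B = 1])
      show "f' integrable_on cbox u v" using ftc[OF uv(1-3)] by auto
      fix D assume D: "D division_of cbox u v"
      have K: "\<exists>p q. p \<le> q \<and> K = {p..q} \<and> a \<le> p \<and> q \<le> b" if "K \<in> D" for K
      proof -
        have "K \<subseteq> {u..v}" "K \<noteq> {}" "\<exists>p q. K = cbox p q"
          using division_ofD(2-4)[OF D that] by auto
        then obtain p q where "K = {p..q}" "p \<le> q" "{p..q} \<subseteq> {u..v}" by auto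
        then show ?thesis using uv by auto
      qed
      have int: "integral K f' = f (Sup K) - f (Inf K)" if "K \<in> D" for K
        using K[OF that] ftc by (auto intro!: integral_unique)
      have "(\<Sum>K\<in>D. norm (integral K f')) = (\<Sum>K\<in>D. norm (f (Sup K) - f (Inf K)))"
        using int by simp
      also have "\<dots> < 1"
      proof (rule d[rule_format, where K = "\<lambda>K. K"])
        show "finite D" using D by blast
        show "(\<Sum>i\<in>D. measure lborel i) < d"
          using additive_content_division[OF D] uv by simp
      qed (use K D in \<open>auto dest: division_ofD(5)\<close>)
      finally show "(\<Sum>K\<in>D. norm (integral K f')) \<le> 1" by simp
    qed
    then show ?thesis by simp
  qed
  \<comment> \<open>Steps of length \<open>d/2\<close> are used because \<open>short\<close> asks
    for a length strictly below \<open>d\<close>.\<close>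
  have "\<forall>v. a \<le> v \<and> v \<le> b \<and> v - a \<le> real n * (d/2) \<longrightarrow> f' absolutely_integrable_on {a..v}" for n
  proof (induction n)
    case 0
    then show ?case using short \<open>d > 0\<close> by auto
  next
    case (Suc n)
    show ?case
    proof (intro allI impI)
      fix v assume v: "a \<le> v \<and> v \<le> b \<and> v - a \<le> real (Suc n) * (d/2)"
      show "f' absolutely_integrable_on {a..v}"
      proof (cases "v - a < d")
        case True
        then show ?thesis using short v by auto
      next
        case False
        have "f' absolutely_integrable_on {a..v - d/2}"
          using Suc.IH v False \<open>d > 0\<close> by (auto simp: algebra_simps)
        moreover have "f' absolutely_integrable_on {v - d/2..v}"
          using v False \<open>d > 0\<close> by (intro short) auto
        ultimately show ?thesis
          by (rule absolutely_integrable_on_combine) (use False \<open>d > 0\<close> in linarith)+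
      qed
    qed
  qed
  moreover obtain n where "b - a \<le> real n * (d/2)"
    using real_arch_simple[of "(b - a) / (d/2)"] \<open>d > 0\<close> by (auto simp: field_simps)
  ultimately show ?thesis using \<open>a \<le> b\<close> by blast
qed

section \<open>Borel measurability of the derivative\<close>

text \<open>The difference quotient is bounded by a non-strict inequality, which is a closed
  condition and so survives limits and extension from rational increments.\<close>

lemma has_vector_derivative_iff_quotient_bound:
  fixes f :: "real \<Rightarrow> 'a::real_normed_vector"
  shows "(f has_vector_derivative D) (at x) \<longleftrightarrow>
    (\<forall>e>0. \<exists>d>0. \<forall>h. h \<noteq> 0 \<and> \<bar>h\<bar> < d \<longrightarrow> norm ((f (x + h) - f x) /\<^sub>R h - D) \<le> e)"
proof -
  have eq: "norm (f (x + h) - f x - h *\<^sub>R D) / \<bar>h\<bar> = norm ((f (x + h) - f x) /\<^sub>R h - D)"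
    if "h \<noteq> 0" for h
  proof -
    have "(f (x + h) - f x) /\<^sub>R h - D = (f (x + h) - f x - h *\<^sub>R D) /\<^sub>R h"
      using that by (simp add: scaleR_diff_right)
    then show ?thesis by (simp add: divide_inverse mult.commute)
  qed
  have "(f has_vector_derivative D) (at x) \<longleftrightarrow>
      (\<forall>e>0. \<exists>d>0. \<forall>h. h \<noteq> 0 \<and> \<bar>h\<bar> < d \<longrightarrow> norm (f (x + h) - f x - h *\<^sub>R D) / \<bar>h\<bar> < e)"
    unfolding has_vector_derivative_def has_derivative_at LIM_eq
    by (simp add: bounded_linear_scaleR_left)
  also have "\<dots> \<longleftrightarrow> (\<forall>e>0. \<exists>d>0. \<forall>h. h \<noteq> 0 \<and> \<bar>h\<bar> < d \<longrightarrow> norm ((f (x + h) - f x) /\<^sub>R h - D) < e)"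
  proof -
    have "(h \<noteq> 0 \<and> \<bar>h\<bar> < d \<longrightarrow> norm (f (x + h) - f x - h *\<^sub>R D) / \<bar>h\<bar> < e) =
      (h \<noteq> 0 \<and> \<bar>h\<bar> < d \<longrightarrow> norm ((f (x + h) - f x) /\<^sub>R h - D) < e)" for h d e
      using eq[of h] by auto
    then show ?thesis by (simp only:)
  qed
  also have "\<dots> \<longleftrightarrow> (\<forall>e>0. \<exists>d>0. \<forall>h. h \<noteq> 0 \<and> \<bar>h\<bar> < d \<longrightarrow> norm ((f (x + h) - f x) /\<^sub>R h - D) \<le> e)"
    (is "?L = ?R")
  proof
    assume ?L then show ?R by (meson less_imp_le)
  next
    assume R: ?R
    show ?L
    proof (intro allI impI)
      fix e :: real assume "e > 0"
      then obtain d where "d > 0" "\<forall>h. h \<noteq> 0 \<and> \<bar>h\<bar> < d \<longrightarrow> norm ((f (x + h) - f x) /\<^sub>R h - D) \<le> e/2"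
        using R half_gt_zero by blast
      then show "\<exists>d>0. \<forall>h. h \<noteq> 0 \<and> \<bar>h\<bar> < d \<longrightarrow> norm ((f (x + h) - f x) /\<^sub>R h - D) < e"
        using \<open>e > 0\<close> by (intro exI[of _ d]) (auto intro: le_less_trans[of _ "e/2"])
    qed
  qed
  finally show ?thesis .
qed

lemma continuous_le_if_le_on_Rats:
  fixes g :: "real \<Rightarrow> real"
  assumes "open S" "continuous_on S g" "\<And>h. h \<in> S \<inter> \<rat> \<Longrightarrow> g h \<le> c" "x \<in> S"
  shows "g x \<le> c"
proof (rule ccontr)
  assume "\<not> g x \<le> c"
  have "open (S \<inter> g -` {c<..})"
    by (rule continuous_open_preimage[OF assms(2,1)]) simp
  moreover have "x \<in> S \<inter> g -` {c<..}" using \<open>\<not> g x \<le> c\<close> assms(4) by auto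
  ultimately obtain e where "e > 0" and e: "ball x e \<subseteq> S \<inter> g -` {c<..}"
    using open_contains_ball by blast
  obtain r where r: "r \<in> \<rat>" "x < r" "r < x + e"
    using Rats_dense_in_real[of x "x + e"] \<open>e > 0\<close> by auto
  then have "r \<in> S \<inter> g -` {c<..}" using e by (auto simp: dist_real_def subset_iff)
  then show False using assms(3)[of r] r by auto
qed

text \<open>The right-hand side has countable quantifiers only, which makes the set of points of
  differentiability Borel. Continuity of \<open>f\<close> extends the Cauchy bound from rational to
  real increments, and completeness supplies the derivative as a limit.\<close>

lemma differentiable_iff_rat_quotients_Cauchy:
  fixes f :: "real \<Rightarrow> 'a::banach"
  assumes cont: "continuous_on UNIV f"
  shows "f differentiable (at x) \<longleftrightarrow>
    (\<forall>k::nat. \<exists>m::nat. \<forall>h h'::rat. h \<noteq> 0 \<and> \<bar>real_of_rat h\<bar> < inverse (Suc m) \<and>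
        h' \<noteq> 0 \<and> \<bar>real_of_rat h'\<bar> < inverse (Suc m) \<longrightarrow>
        norm ((f (x + real_of_rat h) - f x) /\<^sub>R real_of_rat h
            - (f (x + real_of_rat h') - f x) /\<^sub>R real_of_rat h') \<le> inverse (Suc k))"
    (is "_ \<longleftrightarrow> ?R")
proof
  assume "f differentiable (at x)"
  then obtain D where D: "(f has_vector_derivative D) (at x)"
    using vector_derivative_works by blast
  show ?R
  proof
    fix k :: nat
    have "inverse (real (Suc k)) / 2 > 0" by simp
    then obtain d where "d > 0" and d: "\<forall>h. h \<noteq> 0 \<and> \<bar>h\<bar> < d \<longrightarrow>
        norm ((f (x + h) - f x) /\<^sub>R h - D) \<le> inverse (real (Suc k)) / 2"
      using D unfolding has_vector_derivative_iff_quotient_bound by blast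
    obtain m where m: "inverse (real (Suc m)) < d" using reals_Archimedean[OF \<open>d > 0\<close>] by blast
    show "\<exists>m::nat. \<forall>h h'::rat. h \<noteq> 0 \<and> \<bar>real_of_rat h\<bar> < inverse (Suc m) \<and>
        h' \<noteq> 0 \<and> \<bar>real_of_rat h'\<bar> < inverse (Suc m) \<longrightarrow>
        norm ((f (x + real_of_rat h) - f x) /\<^sub>R real_of_rat h
            - (f (x + real_of_rat h') - f x) /\<^sub>R real_of_rat h') \<le> inverse (Suc k)"
    proof (intro exI[of _ m] allI impI)
      fix h h' :: rat
      assume h: "h \<noteq> 0 \<and> \<bar>real_of_rat h\<bar> < inverse (Suc m) \<and>
        h' \<noteq> 0 \<and> \<bar>real_of_rat h'\<bar> < inverse (Suc m)"
      have "norm ((f (x + real_of_rat h) - f x) /\<^sub>R real_of_rat h - D) \<le> inverse (real (Suc k)) / 2"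
        "norm ((f (x + real_of_rat h') - f x) /\<^sub>R real_of_rat h' - D) \<le> inverse (real (Suc k)) / 2"
        using d h m by auto
      then show "norm ((f (x + real_of_rat h) - f x) /\<^sub>R real_of_rat h
            - (f (x + real_of_rat h') - f x) /\<^sub>R real_of_rat h') \<le> inverse (Suc k)"
        using norm_triangle_ineq4[of "(f (x + real_of_rat h) - f x) /\<^sub>R real_of_rat h - D"
            "(f (x + real_of_rat h') - f x) /\<^sub>R real_of_rat h' - D"] by simp
    qed
  qed
next
  assume R: ?R
  define q where "q = (\<lambda>h. (f (x + h) - f x) /\<^sub>R h)"
  have contq: "continuous_on (-{0}) q"
    unfolding q_def
    by (intro continuous_intros continuous_on_compose2[OF cont]) auto
  define S where "S = (\<lambda>m::nat. {h::real. h \<noteq> 0 \<and> \<bar>h\<bar> < inverse (Suc m)})"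
  have opS: "open (S m)" for m
  proof -
    have "S m = ball 0 (inverse (Suc m)) - {0}" by (auto simp: S_def dist_real_def)
    then show ?thesis by (simp add: open_delete)
  qed
  have conS: "continuous_on (S m) q" for m
    by (rule continuous_on_subset[OF contq]) (auto simp: S_def)
  have Cau: "\<exists>m. \<forall>h\<in>S m. \<forall>h'\<in>S m. norm (q h - q h') \<le> inverse (Suc k)" for k :: nat
  proof -
    obtain m where m: "\<forall>h h'::rat. h \<noteq> 0 \<and> \<bar>real_of_rat h\<bar> < inverse (Suc m) \<and>
        h' \<noteq> 0 \<and> \<bar>real_of_rat h'\<bar> < inverse (Suc m) \<longrightarrow>
        norm ((f (x + real_of_rat h) - f x) /\<^sub>R real_of_rat h
            - (f (x + real_of_rat h') - f x) /\<^sub>R real_of_rat h') \<le> inverse (Suc k)"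
      using R by blast
    have rr: "norm (q h - q h') \<le> inverse (Suc k)" if "h \<in> S m \<inter> \<rat>" "h' \<in> S m \<inter> \<rat>" for h h'
      using that m unfolding q_def by (auto elim!: Rats_cases simp: S_def)
    \<comment> \<open>Density of the rationals is applied to one increment at a time: first
      \<open>h\<close> becomes real while \<open>h'\<close> stays rational, then \<open>h'\<close>
      becomes real as well.\<close>
    have r1: "norm (q h - q h') \<le> inverse (Suc k)" if "h \<in> S m" "h' \<in> S m \<inter> \<rat>" for h h'
      by (rule continuous_le_if_le_on_Rats[OF opS _ rr \<open>h \<in> S m\<close>])
        (use that in \<open>auto intro!: continuous_intros conS\<close>)
    have "norm (q h - q h') \<le> inverse (Suc k)" if "h \<in> S m" "h' \<in> S m" for h h'
      by (rule continuous_le_if_le_on_Rats[OF opS _ r1 \<open>h' \<in> S m\<close>])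
        (use that in \<open>auto intro!: continuous_intros conS\<close>)
    then show ?thesis by blast
  qed
  \<comment> \<open>The second \<open>Suc\<close> gives the strict bound
    \<open>y n < inverse (Suc m)\<close> already for \<open>n = m\<close>, as membership in
    \<open>S m\<close> requires.\<close>
  define y where "y = (\<lambda>n::nat. inverse (real (Suc (Suc n))))"
  have yS: "y n \<in> S m" if "n \<ge> m" for n m
    using that by (auto simp: S_def y_def field_simps)
  have "Cauchy (\<lambda>n. q (y n))"
    unfolding Cauchy_iff
  proof (intro allI impI)
    fix e :: real assume "e > 0"
    obtain k where k: "inverse (real (Suc k)) < e" using reals_Archimedean[OF \<open>e > 0\<close>] by blast
    obtain m where "\<forall>h\<in>S m. \<forall>h'\<in>S m. norm (q h - q h') \<le> inverse (Suc k)" using Cau by blast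
    then show "\<exists>M. \<forall>m\<ge>M. \<forall>n\<ge>M. norm (q (y m) - q (y n)) < e"
      using yS k by (intro exI[of _ m]) (meson le_less_trans)
  qed
  then obtain D where D: "(\<lambda>n. q (y n)) \<longlonglongrightarrow> D"
    using Cauchy_convergent_iff convergent_def by blast
  have "(f has_vector_derivative D) (at x)"
    unfolding has_vector_derivative_iff_quotient_bound
  proof (intro allI impI)
    fix e :: real assume "e > 0"
    obtain k where k: "inverse (real (Suc k)) < e" using reals_Archimedean[OF \<open>e > 0\<close>] by blast
    obtain m where m: "\<forall>h\<in>S m. \<forall>h'\<in>S m. norm (q h - q h') \<le> inverse (Suc k)" using Cau by blast
    show "\<exists>d>0. \<forall>h. h \<noteq> 0 \<and> \<bar>h\<bar> < d \<longrightarrow> norm ((f (x + h) - f x) /\<^sub>R h - D) \<le> e"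
    proof (intro exI[of _ "inverse (real (Suc m))"] conjI allI impI)
      fix h assume "h \<noteq> 0 \<and> \<bar>h\<bar> < inverse (real (Suc m))"
      then have h: "h \<in> S m" by (simp add: S_def)
      have "(\<lambda>n. norm (q h - q (y n))) \<longlonglongrightarrow> norm (q h - D)"
        by (intro tendsto_intros D)
      moreover have "\<forall>n\<ge>m. norm (q h - q (y n)) \<le> e"
        using m h yS k by (meson less_imp_le order.trans)
      ultimately have "norm (q h - D) \<le> e"
        by (intro LIMSEQ_le_const2) auto
      then show "norm ((f (x + h) - f x) /\<^sub>R h - D) \<le> e" by (simp add: q_def)
    qed simp
  qed
  then show "f differentiable (at x)" by (rule differentiableI_vector)
qed

text \<open>Off the differentiability set \<open>vector_derivative\<close> is a constant junk value, so measurability of that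
  set suffices.\<close>

lemma borel_measurable_vector_derivative:
  fixes f :: "real \<Rightarrow> 'a::{banach, second_countable_topology}"
  assumes cont: "continuous_on UNIV f"
  shows "(\<lambda>x. vector_derivative f (at x)) \<in> borel_measurable borel"
proof -
  have [measurable]: "f \<in> borel_measurable borel"
    using cont by (rule borel_measurable_continuous_onI)
  have P[measurable]: "Measurable.pred borel (\<lambda>x. f differentiable (at x))"
    unfolding differentiable_iff_rat_quotients_Cauchy[OF cont] by measurable
  define z where "z = (\<lambda>n. inverse (real (Suc n)))"
  \<comment> \<open>Where the derivative exists it is a limit along one fixed sequence of
    increments. Elsewhere no candidate satisfies the defining predicate, so the choice operator is
    applied to the constantly false predicate and returns the same value at all such points.\<close>
  have "vector_derivative f (at x) =
      (if f differentiable (at x) then lim (\<lambda>n. (f (x + z n) - f x) /\<^sub>R z n) else (SOME D. False))" for x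
  proof (cases "f differentiable (at x)")
    case True
    then have "(f has_vector_derivative vector_derivative f (at x)) (at x)"
      using vector_derivative_works by blast
    note q = this[unfolded has_vector_derivative_iff_quotient_bound, rule_format]
    have "(\<lambda>n. (f (x + z n) - f x) /\<^sub>R z n) \<longlonglongrightarrow> vector_derivative f (at x)"
      unfolding LIMSEQ_iff
    proof (intro allI impI)
      fix e :: real assume "e > 0"
      then obtain d where "d > 0" and d: "\<forall>h. h \<noteq> 0 \<and> \<bar>h\<bar> < d \<longrightarrow>
          norm ((f (x + h) - f x) /\<^sub>R h - vector_derivative f (at x)) \<le> e/2"
        using q[of "e/2"] by auto
      obtain m where m: "inverse (real (Suc m)) < d" using reals_Archimedean[OF \<open>d > 0\<close>] by blast
      have "z n < d" "z n > 0" if "n \<ge> m" for n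
      proof -
        have "z n \<le> inverse (real (Suc m))" using that by (simp add: z_def field_simps)
        then show "z n < d" using m by linarith
        show "z n > 0" by (simp add: z_def)
      qed
      then have "\<forall>n\<ge>m. norm ((f (x + z n) - f x) /\<^sub>R z n - vector_derivative f (at x)) \<le> e/2"
        using d by (metis abs_of_pos less_irrefl)
      then show "\<exists>m. \<forall>n\<ge>m. norm ((f (x + z n) - f x) /\<^sub>R z n - vector_derivative f (at x)) < e"
        using \<open>e > 0\<close> by (intro exI[of _ m]) (auto intro: le_less_trans[of _ "e/2"])
    qed
    then show ?thesis using True limI by force
  next
    case False
    then have "\<not> (f has_vector_derivative D) (at x)" for D
      using differentiableI_vector by blast
    then show ?thesis using False by (simp add: vector_derivative_def)
  qed
  then show ?thesis by (simp add: fun_eq_iff[symmetric])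
qed

text \<open>Clamping the argument extends \<open>f\<close> to a continuous function on the line
  which agrees with \<open>f\<close> near each interior point. At \<open>a\<close> and
  \<open>b\<close> the extension may have another derivative or none, hence the open
  interval.\<close>

lemma borel_measurable_vector_derivative_Ioo:
  fixes f :: "real \<Rightarrow> 'a::{banach, second_countable_topology}"
  assumes cont: "continuous_on {a..b} f"
  shows "(\<lambda>x. if x \<in> {a<..<b} then vector_derivative f (at x) else 0) \<in> borel_measurable borel"
proof -
  define g where "g = (\<lambda>x. f (clamp a b x))"
  have "continuous_on UNIV g"
    unfolding g_def by (rule clamp_continuous_on) (use cont in simp)
  then have [measurable]: "(\<lambda>x. vector_derivative g (at x)) \<in> borel_measurable borel"
    by (rule borel_measurable_vector_derivative)
  have "vector_derivative f (at x) = vector_derivative g (at x)" if x: "x \<in> {a<..<b}" for x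
  proof (rule vector_derivative_cong_eq)
    show "\<forall>\<^sub>F x in nhds x. x \<in> UNIV \<longrightarrow> f x = g x"
      using eventually_nhds_in_open[OF open_greaterThanLessThan x]
      by eventually_elim (auto simp: g_def)
  qed auto
  then have "(\<lambda>x. if x \<in> {a<..<b} then vector_derivative f (at x) else 0) =
     (\<lambda>x. if x \<in> {a<..<b} then vector_derivative g (at x) else 0)" by auto
  also have "\<dots> \<in> borel_measurable borel" by measurable
  finally show ?thesis .
qed

section \<open>Increments of horizontal curves\<close>

lemma Ubr_eq_cross3: "Ubr x x' = cross3 x' x"
  by (simp add: Ubr_def Ucoef_def Uskew_def cross3_def vec_eq_iff forall_3 axis_def
      matrix_vector_mult_def inner_vec_def sum_3 algebra_simps)

lemma norm_cross3_le: "norm (cross3 x y) \<le> norm x * norm y"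
proof -
  have "(norm (cross3 x y))\<^sup>2 \<le> (norm x * norm y)\<^sup>2"
    by (simp add: norm_cross power_mult_distrib)
  then show ?thesis by (rule power2_le_imp_le) simp
qed

text \<open>\<open>horiz_length\<close> is an integral against \<open>lborel\<close>, while absolute
  integrability refers to the completed measure. Borel measurability of the speed is what permits
  the passage between the two; a non-measurable integrand would give the default value 0.\<close>

lemma horiz_length_eq_integral:
  assumes cont: "continuous_on {0..1} \<gamma>"
    and int: "(\<lambda>s. vector_derivative \<gamma> (at s)) absolutely_integrable_on {0..1}"
  shows "horiz_length \<gamma> = integral {0..1} (\<lambda>s. norm (fst (vector_derivative \<gamma> (at s))))"
proof -
  define n where "n = (\<lambda>s. norm (fst (vector_derivative \<gamma> (at s))))"
  define m where "m = (\<lambda>s. if s \<in> {0<..<1} then vector_derivative \<gamma> (at s) else 0)"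
  have [measurable]: "m \<in> borel_measurable borel"
    unfolding m_def by (rule borel_measurable_vector_derivative_Ioo[OF cont])
  have [measurable]: "(\<lambda>s. fst (m s)) \<in> borel_measurable borel"
    by (rule measurable_compose[OF _ borel_measurable_continuous_onI[OF continuous_on_fst[OF continuous_on_id]]])
      simp
  define h where "h = (\<lambda>s. indicator {0..1} s *\<^sub>R n s)"
  \<comment> \<open>The measurable version \<open>m\<close> vanishes at both endpoints, so the
    values of the speed at 0 and 1 are put back by indicators of single points.\<close>
  have "h = (\<lambda>s. norm (fst (m s)) + indicator {0} s *\<^sub>R n 0 + indicator {1} s *\<^sub>R n 1)"
    by (auto simp: h_def m_def n_def fun_eq_iff indicator_def)
  also have "\<dots> \<in> borel_measurable borel" by measurable
  finally have hm: "h \<in> borel_measurable lborel" by simp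
  have "(fst \<circ> (\<lambda>s. vector_derivative \<gamma> (at s))) absolutely_integrable_on {0..1}"
    by (rule absolutely_integrable_linear[OF int bounded_linear_fst])
  then have "n absolutely_integrable_on {0..1}"
    unfolding n_def o_def by (rule absolutely_integrable_norm[unfolded o_def])
  then have "integrable lebesgue h" by (simp add: set_integrable_def h_def)
  then have "integrable lborel h" using integrable_completion[OF hm] by simp
  then have "set_integrable lborel {0..1} n" by (simp add: set_integrable_def h_def)
  then show ?thesis
    unfolding horiz_length_def n_def by (rule set_borel_integral_eq_integral(2))
qed

text \<open>Extracts all that the lower bound uses of a curve: its arc length function
  \<open>l\<close> and two increment estimates. With \<open>x\<close> the horizontal part and
  \<open>c\<close> the left end of the interval, the vertical remainder is the integral of half the
  cross product of \<open>x'\<close> with \<open>x - x(c)\<close>. As \<open>x - x(c)\<close> is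
  bounded by the arc length of the interval, the remainder is quadratic in it.\<close>

lemma horizontal_curve_increments:
  assumes "horizontal_curve \<gamma> g"
  obtains l where "continuous_on {0..1} l" "l 0 = 0" "l 1 = horiz_length \<gamma>"
    "\<And>c d. 0 \<le> c \<Longrightarrow> c \<le> d \<Longrightarrow> d \<le> 1 \<Longrightarrow> norm (fst (\<gamma> d) - fst (\<gamma> c)) \<le> l d - l c"
    "\<And>c d. 0 \<le> c \<Longrightarrow> c \<le> d \<Longrightarrow> d \<le> 1 \<Longrightarrow>
      norm (snd (\<gamma> d) - snd (\<gamma> c) - (1/2) *\<^sub>R Ubr (fst (\<gamma> c)) (fst (\<gamma> d) - fst (\<gamma> c)))
        \<le> (l d - l c)\<^sup>2"
proof -
  define v where "v = (\<lambda>s. vector_derivative \<gamma> (at s))"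
  have ac: "abs_cont_on 0 1 \<gamma>" using assms by (simp add: horizontal_curve_def)
  have cont: "continuous_on {0..1} \<gamma>" by (rule abs_cont_on_imp_continuous_on[OF ac])
  have "AE s in lborel. s \<in> {0..1} \<longrightarrow> \<gamma> differentiable (at s) \<and>
        snd (v s) = (1/2) *\<^sub>R Ubr (fst (\<gamma> s)) (fst (v s))"
    using assms by (simp add: horizontal_curve_def v_def)
  \<comment> \<open>One null set collects the parameters where the curve fails to be differentiable
    or to be horizontal.\<close>
  then obtain N where N0: "N \<in> null_sets lborel" and N1: "{s \<in> space lborel. \<not> (s \<in> {0..1} \<longrightarrow>
      \<gamma> differentiable (at s) \<and> snd (v s) = (1/2) *\<^sub>R Ubr (fst (\<gamma> s)) (fst (v s)))} \<subseteq> N"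
    unfolding eventually_ae_filter by blast
  have N: "negligible N" using N0 by (simp add: negligible_iff_null_sets null_sets_completionI)
  have der: "(\<gamma> has_vector_derivative v s) (at s)"
    and hor: "snd (v s) = (1/2) *\<^sub>R Ubr (fst (\<gamma> s)) (fst (v s))" if "s \<in> {0..1} - N" for s
  proof -
    have "\<gamma> differentiable (at s) \<and> snd (v s) = (1/2) *\<^sub>R Ubr (fst (\<gamma> s)) (fst (v s))"
      using N1 that by auto
    then show "(\<gamma> has_vector_derivative v s) (at s)"
      "snd (v s) = (1/2) *\<^sub>R Ubr (fst (\<gamma> s)) (fst (v s))"
      using vector_derivative_works by (auto simp: v_def)
  qed
  have abs: "v absolutely_integrable_on {0..1}"
    by (rule abs_cont_on_derivative_absolutely_integrable[OF _ ac N der]) auto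
  have ftc: "(v has_integral (\<gamma> d - \<gamma> c)) {c..d}" if cd: "0 \<le> c" "c \<le> d" "d \<le> 1" for c d
  proof (rule fundamental_theorem_of_calculus_abs_cont[OF \<open>c \<le> d\<close> _ N])
    show "abs_cont_on c d \<gamma>" using abs_cont_on_subinterval[OF ac] cd by blast
    show "(\<gamma> has_vector_derivative v x) (at x within {c..d})" if "x \<in> {c..d} - N" for x
      by (rule has_vector_derivative_at_within, rule der) (use that cd in auto)
  qed
  define X where "X = (\<lambda>s. fst (v s))"
  define n where "n = (\<lambda>s. norm (X s))"
  have X: "(X has_integral (fst (\<gamma> d) - fst (\<gamma> c))) {c..d}"
    and T: "((\<lambda>s. snd (v s)) has_integral (snd (\<gamma> d) - snd (\<gamma> c))) {c..d}"
    if "0 \<le> c" "c \<le> d" "d \<le> 1" for c d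
    using has_integral_linear[OF ftc[OF that] bounded_linear_fst]
      has_integral_linear[OF ftc[OF that] bounded_linear_snd] by (simp_all add: o_def X_def)
  have "X absolutely_integrable_on {0..1}"
    using absolutely_integrable_linear[OF abs bounded_linear_fst] by (simp add: o_def X_def)
  then have "n absolutely_integrable_on {0..1}"
    unfolding n_def by (rule absolutely_integrable_norm[unfolded o_def])
  then have n01: "n integrable_on {0..1}"
    using set_lebesgue_integral_eq_integral(1) by blast
  define l where "l = (\<lambda>s. integral {0..s} n)"
  have nint: "n integrable_on {c..d}" if "0 \<le> c" "d \<le> 1" for c d
    using integrable_subinterval_real[OF n01] that by auto
  have ldiff: "l d - l c = integral {c..d} n" if "0 \<le> c" "c \<le> d" "d \<le> 1" for c d
    using Henstock_Kurzweil_Integration.integral_combine[OF that(1,2) nint] that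
    by (simp add: l_def algebra_simps)
  have xinc: "norm (fst (\<gamma> d) - fst (\<gamma> c)) \<le> l d - l c" if cd: "0 \<le> c" "c \<le> d" "d \<le> 1" for c d
  proof -
    have "norm (integral {c..d} X) \<le> integral {c..d} n"
      using X[OF cd] nint[of c d] cd
      by (intro integral_norm_bound_integral) (auto simp: n_def)
    then show ?thesis using integral_unique[OF X[OF cd]] ldiff[OF cd] by simp
  qed
  show thesis
  proof (rule that[of l])
    show "continuous_on {0..1} l"
      unfolding l_def by (rule indefinite_integral_continuous_1[OF n01])
    show "l 0 = 0" by (simp add: l_def)
    show "l 1 = horiz_length \<gamma>"
      using horiz_length_eq_integral[OF cont abs[unfolded v_def]]
      by (simp add: l_def n_def X_def v_def)
    fix c d :: real assume cd: "0 \<le> c" "c \<le> d" "d \<le> 1"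
    show "norm (fst (\<gamma> d) - fst (\<gamma> c)) \<le> l d - l c" by (rule xinc[OF cd])
    \<comment> \<open>The integrand of the vertical remainder: the base point is subtracted from the
      position, because the part of the integrand with the position frozen at \<open>c\<close>
      integrates exactly to the first-order term.\<close>
    define h where "h = (\<lambda>s. (1/2) *\<^sub>R cross3 (X s) (fst (\<gamma> s) - fst (\<gamma> c)))"
    have T': "((\<lambda>s. (1/2) *\<^sub>R cross3 (X s) (fst (\<gamma> s))) has_integral (snd (\<gamma> d) - snd (\<gamma> c))) {c..d}"
      by (rule has_integral_spike[OF N _ T[OF cd]]) (use hor cd in \<open>auto simp: Ubr_eq_cross3 X_def\<close>)
    have "linear (\<lambda>z. (1/2) *\<^sub>R cross3 z (fst (\<gamma> c)))"
      by (rule linearI) (simp_all add: cross3_def vec_eq_iff forall_3 algebra_simps)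
    then have lin: "bounded_linear (\<lambda>z. (1/2) *\<^sub>R cross3 z (fst (\<gamma> c)))"
      by (simp add: linear_conv_bounded_linear)
    have h_eq: "h = (\<lambda>s. (1/2) *\<^sub>R cross3 (X s) (fst (\<gamma> s)) - (1/2) *\<^sub>R cross3 (X s) (fst (\<gamma> c)))"
      by (simp add: h_def fun_eq_iff cross3_def vec_eq_iff forall_3 algebra_simps)
    have "(h has_integral (snd (\<gamma> d) - snd (\<gamma> c)
        - (1/2) *\<^sub>R cross3 (fst (\<gamma> d) - fst (\<gamma> c)) (fst (\<gamma> c)))) {c..d}"
      unfolding h_eq using has_integral_diff[OF T' has_integral_linear[OF X[OF cd] lin]]
      by (simp add: o_def)
    note H = this
    have "norm (integral {c..d} h) \<le> integral {c..d} (\<lambda>s. (l d - l c) * n s)"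
    proof (rule integral_norm_bound_integral)
      show "h integrable_on {c..d}" using H by blast
      show "(\<lambda>s. (l d - l c) * n s) integrable_on {c..d}"
        using integrable_cmul[OF nint[of c d], of "l d - l c"] cd by simp
      fix s assume s: "s \<in> {c..d}"
      have "norm (h s) \<le> 1/2 * (norm (X s) * norm (fst (\<gamma> s) - fst (\<gamma> c)))"
        using norm_cross3_le[of "X s" "fst (\<gamma> s) - fst (\<gamma> c)"] by (simp add: h_def)
      also have "\<dots> \<le> n s * norm (fst (\<gamma> s) - fst (\<gamma> c))" by (simp add: n_def)
      also have "\<dots> \<le> n s * (l d - l c)"
      proof (rule mult_left_mono)
        have "norm (fst (\<gamma> s) - fst (\<gamma> c)) \<le> l s - l c" using xinc[of c s] s cd by auto
        moreover have "0 \<le> l d - l s"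
          using order.trans[OF norm_ge_zero xinc[of s d]] s cd by auto
        ultimately show "norm (fst (\<gamma> s) - fst (\<gamma> c)) \<le> l d - l c" by linarith
      qed (simp add: n_def)
      finally show "norm (h s) \<le> (l d - l c) * n s" by (simp add: mult.commute)
    qed
    also have "\<dots> = (l d - l c)\<^sup>2" by (simp add: ldiff[OF cd] power2_eq_square)
    finally show "norm (snd (\<gamma> d) - snd (\<gamma> c)
        - (1/2) *\<^sub>R Ubr (fst (\<gamma> c)) (fst (\<gamma> d) - fst (\<gamma> c))) \<le> (l d - l c)\<^sup>2"
      using integral_unique[OF H] by (simp add: Ubr_eq_cross3)
  qed
qed

section \<open>The Riccati lower bound\<close>

text \<open>Cut the parameter interval so that \<open>l\<close> grows by \<open>L / n\<close> on
  each piece. The total increase of \<open>F\<close> is then at most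
  \<open>n * C * (L / n)\<^sup>2\<close>, which tends to 0. Cutting by values of \<open>l\<close>
  rather than by the parameter plays the part of a reparametrisation by arc length.\<close>

lemma quadratic_increments_imp_le:
  fixes F l :: "real \<Rightarrow> real"
  assumes cont: "continuous_on {0..1} l"
    and mono: "\<And>c d. 0 \<le> c \<Longrightarrow> c \<le> d \<Longrightarrow> d \<le> 1 \<Longrightarrow> l c \<le> l d"
    and inc: "\<And>c d. 0 \<le> c \<Longrightarrow> c \<le> d \<Longrightarrow> d \<le> 1 \<Longrightarrow> F d - F c \<le> C * (l d - l c)\<^sup>2"
  shows "F 1 \<le> F 0"
proof (cases "l 1 = l 0")
  case True
  then show ?thesis using inc[of 0 1] by simp
next
  case False
  define L where "L = l 1 - l 0"
  have "L > 0" using mono[of 0 1] False by (simp add: L_def)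
  have bound: "F 1 - F 0 \<le> C * L\<^sup>2 / real n" if "n > 0" for n :: nat
  proof -
    have "\<exists>s. 0 \<le> s \<and> s \<le> 1 \<and> l s = l 0 + L * (real i / real n)" if "i \<le> n" for i
    proof (rule IVT')
      show "l 0 \<le> l 0 + L * (real i / real n)" using \<open>L > 0\<close> by simp
      have "L * (real i / real n) \<le> L * 1"
        using \<open>L > 0\<close> \<open>n > 0\<close> that by (intro mult_left_mono) auto
      then show "l 0 + L * (real i / real n) \<le> l 1" by (simp add: L_def)
    qed (use cont in auto)
    then obtain s0 where s0: "\<And>i. i \<le> n \<Longrightarrow> 0 \<le> s0 i \<and> s0 i \<le> 1 \<and> l (s0 i) = l 0 + L * (real i / real n)"
      by metis
    \<comment> \<open>The intermediate value theorem may return other points where \<open>l\<close>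
      takes its first or last value, since \<open>l\<close> can be constant on intervals; the two
      ends are therefore fixed as 0 and 1, which the telescoping sum needs.\<close>
    define s where "s = (\<lambda>i. if i = 0 then 0 else if i = n then 1 else s0 i)"
    have s: "0 \<le> s i \<and> s i \<le> 1 \<and> l (s i) = l 0 + L * (real i / real n)" if "i \<le> n" for i
      using s0[OF that] \<open>n > 0\<close> by (auto simp: s_def L_def)
    have step: "F (s (Suc i)) - F (s i) \<le> C * (L / real n)\<^sup>2" if "i < n" for i
    proof -
      have diff: "l (s (Suc i)) - l (s i) = L / real n"
        using s[of i] s[of "Suc i"] that by (simp add: add_divide_distrib distrib_left)
      have "s i \<le> s (Suc i)"
      proof (rule ccontr)
        assume "\<not> s i \<le> s (Suc i)"
        then have "l (s (Suc i)) \<le> l (s i)"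
          using mono[of "s (Suc i)" "s i"] s[of i] s[of "Suc i"] that by auto
        moreover have "L / real n > 0" using \<open>L > 0\<close> \<open>n > 0\<close> by simp
        ultimately show False using diff by linarith
      qed
      then have "F (s (Suc i)) - F (s i) \<le> C * (l (s (Suc i)) - l (s i))\<^sup>2"
        using inc[of "s i" "s (Suc i)"] s[of i] s[of "Suc i"] that by auto
      then show ?thesis by (simp add: diff)
    qed
    have "F 1 - F 0 = (\<Sum>i<n. F (s (Suc i)) - F (s i))"
      using \<open>n > 0\<close> sum_lessThan_telescope[of "\<lambda>i. F (s i)" n] by (simp add: s_def)
    also have "\<dots> \<le> (\<Sum>i<n. C * (L / real n)\<^sup>2)" using step by (intro sum_mono) auto
    also have "\<dots> = C * L\<^sup>2 / real n" using \<open>n > 0\<close> by (simp add: field_simps power2_eq_square)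
    finally show ?thesis .
  qed
  have "(\<lambda>n. C * L\<^sup>2 / real n) \<longlonglongrightarrow> 0" by (rule lim_const_over_n)
  then have "F 1 - F 0 \<le> 0"
    using bound by (intro LIMSEQ_le_const[of _ 0]) (auto intro: exI[of _ 1])
  then show ?thesis by simp
qed

text \<open>Compactness bounds \<open>m\<close> by some \<open>B\<close>. The equation then bounds
  the derivative by \<open>P = B\<^sup>2 + c\<close>, and hence \<open>m\<^sup>2\<close> is
  Lipschitz with constant \<open>2 * B * P\<close>. The mean value theorem turns this into the
  second-order estimate, and \<open>K\<close> dominates all three constants.\<close>

lemma riccati_increment_bounds:
  fixes m :: "real \<Rightarrow> real"
  assumes der: "\<And>s. s \<in> {0..1} \<Longrightarrow> (m has_real_derivative - ((m s)\<^sup>2 + c)) (at s)" and "c \<ge> 0"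
  obtains K where "K \<ge> 0"
    "\<And>u. 0 \<le> u \<Longrightarrow> u \<le> 1 \<Longrightarrow> \<bar>m u\<bar> \<le> K"
    "\<And>u v. 0 \<le> u \<Longrightarrow> u \<le> v \<Longrightarrow> v \<le> 1 \<Longrightarrow> \<bar>m v - m u\<bar> \<le> K * (v - u)"
    "\<And>u v. 0 \<le> u \<Longrightarrow> u \<le> v \<Longrightarrow> v \<le> 1 \<Longrightarrow>
      \<bar>m v - m u + ((m u)\<^sup>2 + c) * (v - u)\<bar> \<le> K * (v - u)\<^sup>2"
proof -
  have "continuous_on {0..1} m"
    using der by (meson DERIV_continuous continuous_at_imp_continuous_on)
  then have "compact (m ` {0..1})" by (intro compact_continuous_image) auto
  then obtain B where "B > 0" and B: "\<And>u. 0 \<le> u \<Longrightarrow> u \<le> 1 \<Longrightarrow> \<bar>m u\<bar> \<le> B"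
    using compact_imp_bounded bounded_pos by (metis atLeastAtMost_iff imageI real_norm_def)
  have sq: "(m u)\<^sup>2 \<le> B\<^sup>2" if "0 \<le> u" "u \<le> 1" for u
    using B[OF that] \<open>B > 0\<close> by (simp add: abs_le_square_iff[symmetric])
  have mvt: "\<exists>w. u \<le> w \<and> w \<le> v \<and> m v - m u = - ((m w)\<^sup>2 + c) * (v - u)"
    if "0 \<le> u" "u \<le> v" "v \<le> 1" for u v
  proof (cases "u = v")
    case False
    then have "\<exists>w>u. w < v \<and> m v - m u = (v - u) * - ((m w)\<^sup>2 + c)"
      using that by (intro MVT2 der) auto
    then show ?thesis by (metis less_imp_le mult.commute)
  qed auto
  define P where "P = B\<^sup>2 + c"
  have "P \<ge> 0" using \<open>c \<ge> 0\<close> by (simp add: P_def)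
  have lip: "\<bar>m v - m u\<bar> \<le> P * (v - u)" if uv: "0 \<le> u" "u \<le> v" "v \<le> 1" for u v
  proof -
    obtain w where w: "u \<le> w" "w \<le> v" "m v - m u = - ((m w)\<^sup>2 + c) * (v - u)"
      using mvt[OF uv] by blast
    have "\<bar>m v - m u\<bar> = ((m w)\<^sup>2 + c) * (v - u)"
    proof -
      have "0 \<le> ((m w)\<^sup>2 + c) * (v - u)" using uv \<open>c \<ge> 0\<close> by simp
      moreover have "m v - m u = - (((m w)\<^sup>2 + c) * (v - u))" unfolding w(3) by (rule mult_minus_left)
      ultimately show ?thesis by linarith
    qed
    also have "\<dots> \<le> P * (v - u)"
      using sq[of w] w uv by (intro mult_right_mono) (auto simp: P_def)
    finally show ?thesis .
  qed
  define K where "K = B + P + 2 * B * P"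
  have K: "B \<le> K" "P \<le> K" "2 * B * P \<le> K" "K \<ge> 0"
    using \<open>B > 0\<close> \<open>P \<ge> 0\<close> by (auto simp: K_def)
  show thesis
  proof (rule that[OF K(4)])
    show "\<bar>m u\<bar> \<le> K" if "0 \<le> u" "u \<le> 1" for u using B[OF that] K by linarith
    fix u v :: real assume uv: "0 \<le> u" "u \<le> v" "v \<le> 1"
    have "P * (v - u) \<le> K * (v - u)" using K uv by (intro mult_right_mono) auto
    then show "\<bar>m v - m u\<bar> \<le> K * (v - u)" using lip[OF uv] by linarith
    obtain w where w: "u \<le> w" "w \<le> v" "m v - m u = - ((m w)\<^sup>2 + c) * (v - u)"
      using mvt[OF uv] by blast
    have "\<bar>m u - m w\<bar> \<le> P * (v - u)"
    proof -
      have "P * (w - u) \<le> P * (v - u)" using w \<open>P \<ge> 0\<close> by (intro mult_left_mono) auto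
      then show ?thesis using lip[of u w] w uv by (simp add: abs_minus_commute)
    qed
    moreover have "\<bar>m u + m w\<bar> \<le> 2 * B" using B[of u] B[of w] uv w by linarith
    ultimately have "\<bar>m u + m w\<bar> * \<bar>m u - m w\<bar> \<le> 2 * B * (P * (v - u))"
      using \<open>B > 0\<close> by (intro mult_mono) auto
    also have "\<dots> \<le> K * (v - u)"
      using mult_right_mono[OF K(3), of "v - u"] uv by (simp add: mult.assoc)
    finally have 1: "\<bar>(m u)\<^sup>2 - (m w)\<^sup>2\<bar> \<le> K * (v - u)"
      by (simp add: power2_eq_square square_diff_square_factored abs_mult)
    have "m v - m u + ((m u)\<^sup>2 + c) * (v - u) = ((m u)\<^sup>2 - (m w)\<^sup>2) * (v - u)"
      using w by (simp add: algebra_simps)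
    then have "\<bar>m v - m u + ((m u)\<^sup>2 + c) * (v - u)\<bar> = \<bar>(m u)\<^sup>2 - (m w)\<^sup>2\<bar> * (v - u)"
      using uv by (simp add: abs_mult)
    also have "\<dots> \<le> K * (v - u) * (v - u)" using 1 uv by (intro mult_right_mono) auto
    finally show "\<bar>m v - m u + ((m u)\<^sup>2 + c) * (v - u)\<bar> \<le> K * (v - u)\<^sup>2"
      by (simp add: power2_eq_square mult.assoc)
  qed
qed

text \<open>The first-order part of the increment is \<open>- q |w|\<^sup>2 + 2 w \<cdot> dx - L\<^sup>2 q\<close>, which is nonpositive
  because \<open>|dx| \<le> L q\<close>; the Riccati equations are exactly what makes the square complete.\<close>

lemma riccati_step_estimate:
  fixes x dx e dt :: "real^3"
  assumes e: "norm e = 1" and "k > 0" and "L \<ge> 0" and "K \<ge> 0"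
    and q: "0 \<le> q" "q \<le> 1" and x: "norm x \<le> L" and dx: "norm dx \<le> L * q"
    and K0: "\<bar>\<alpha>\<bar> \<le> K" "\<bar>\<beta>\<bar> \<le> K"
    and K1: "\<bar>\<alpha>' - \<alpha>\<bar> \<le> K * q" "\<bar>\<beta>' - \<beta>\<bar> \<le> K * q"
    and K2: "\<bar>\<alpha>' - \<alpha> + \<alpha>\<^sup>2 * q\<bar> \<le> K * q\<^sup>2" "\<bar>\<beta>' - \<beta> + (\<beta>\<^sup>2 + k\<^sup>2) * q\<bar> \<le> K * q\<^sup>2"
    and dt: "norm (dt - (1/2) *\<^sub>R cross3 dx x) \<le> (L * q)\<^sup>2"
  shows "(\<alpha>' * (e \<bullet> (x + dx))\<^sup>2 + \<beta>' * ((norm (x + dx))\<^sup>2 - (e \<bullet> (x + dx))\<^sup>2))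
      - (\<alpha> * (e \<bullet> x)\<^sup>2 + \<beta> * ((norm x)\<^sup>2 - (e \<bullet> x)\<^sup>2))
      + 4 * ((k *\<^sub>R e) \<bullet> dt) - L\<^sup>2 * q \<le> (12 * K + 4 * k) * (L * q)\<^sup>2"
proof -
  \<comment> \<open>Everything is split along \<open>e\<close> and its orthogonal complement:
    \<open>a\<close> and \<open>da\<close> are the components along \<open>e\<close>,
    \<open>n2\<close> and \<open>dy\<close> the squared lengths of the orthogonal parts of
    \<open>x\<close> and \<open>dx\<close>, and \<open>y\<close> the inner product of these
    parts.\<close>
  define a da where "a = e \<bullet> x" and "da = e \<bullet> dx"
  define n2 where "n2 = (norm x)\<^sup>2 - a\<^sup>2"
  define y dy where "y = x \<bullet> dx - a * da" and "dy = (norm dx)\<^sup>2 - da\<^sup>2"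
  define r where "r = L * q"
  have "r \<ge> 0" "r \<le> L"
    using \<open>L \<ge> 0\<close> q mult_left_mono[of q 1 L] by (auto simp: r_def)
  have aL: "\<bar>a\<bar> \<le> L" "\<bar>da\<bar> \<le> r"
    using Cauchy_Schwarz_ineq2[of e x] Cauchy_Schwarz_ineq2[of e dx] e x dx
    by (auto simp: a_def da_def r_def)
  have a2: "a\<^sup>2 \<le> (norm x)\<^sup>2" "da\<^sup>2 \<le> (norm dx)\<^sup>2"
    using Cauchy_Schwarz_ineq2[of e x] Cauchy_Schwarz_ineq2[of e dx] e
    by (auto simp: a_def da_def abs_le_square_iff[symmetric])
  have sq: "a\<^sup>2 \<le> L\<^sup>2" "n2 \<ge> 0" "n2 \<le> L\<^sup>2" "0 \<le> dy" "dy \<le> r\<^sup>2" "da\<^sup>2 \<le> r\<^sup>2"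
  proof -
    have "(norm x)\<^sup>2 \<le> L\<^sup>2" "(norm dx)\<^sup>2 \<le> r\<^sup>2"
      using power_mono[OF x, of 2] power_mono[OF dx, of 2] by (simp_all add: r_def)
    then show "a\<^sup>2 \<le> L\<^sup>2" "n2 \<ge> 0" "n2 \<le> L\<^sup>2" "0 \<le> dy" "dy \<le> r\<^sup>2" "da\<^sup>2 \<le> r\<^sup>2"
      using a2 zero_le_power2[of a] zero_le_power2[of da] unfolding n2_def dy_def by linarith+
  qed
  have ada: "\<bar>a * da\<bar> \<le> L * r"
    unfolding abs_mult using aL \<open>L \<ge> 0\<close> by (intro mult_mono) auto
  have "\<bar>x \<bullet> dx\<bar> \<le> norm x * norm dx" by (rule Cauchy_Schwarz_ineq2)
  also have "\<dots> \<le> L * r" using x dx \<open>L \<ge> 0\<close> by (intro mult_mono) (auto simp: r_def)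
  finally have y: "\<bar>y\<bar> \<le> 2 * (L * r)" using ada by (simp add: y_def)
  \<comment> \<open>This is \<open>M x + A x\<close>, where \<open>M\<close> multiplies by
    \<open>\<alpha>\<close> along \<open>e\<close> and by \<open>\<beta>\<close> on the complement,
    and \<open>A x\<close> is the cross product of \<open>x\<close> with
    \<open>k *\<^sub>R e\<close>. That product is orthogonal to both \<open>e\<close> and
    \<open>x\<close>, so the mixed terms in the square of the norm vanish.\<close>
  define w where "w = ((\<alpha> - \<beta>) * a) *\<^sub>R e + \<beta> *\<^sub>R x + cross3 x (k *\<^sub>R e)"
  have ee: "e \<bullet> e = 1" using e by (simp add: power2_norm_eq_inner[symmetric])
  have cr: "cross3 x (k *\<^sub>R e) \<bullet> e = 0" "cross3 x (k *\<^sub>R e) \<bullet> x = 0"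
    by (simp_all add: dot_cross_self cross_mult_right)
  have cr2: "cross3 x (k *\<^sub>R e) \<bullet> cross3 x (k *\<^sub>R e) = k\<^sup>2 * n2"
    unfolding power2_norm_eq_inner[symmetric] norm_cross
    using e by (simp add: n2_def a_def inner_commute power_mult_distrib algebra_simps)
  have w2: "(norm w)\<^sup>2 = \<alpha>\<^sup>2 * a\<^sup>2 + (\<beta>\<^sup>2 + k\<^sup>2) * n2"
  proof -
    have "(norm w)\<^sup>2 = ((\<alpha> - \<beta>) * a)\<^sup>2 + \<beta>\<^sup>2 * (x \<bullet> x) + k\<^sup>2 * n2 + 2 * ((\<alpha> - \<beta>) * a) * \<beta> * a"
    proof -
      have expand: "(p *\<^sub>R e + \<beta> *\<^sub>R x + c) \<bullet> (p *\<^sub>R e + \<beta> *\<^sub>R x + c) = p\<^sup>2 * (e \<bullet> e) + \<beta>\<^sup>2 * (x \<bullet> x) + c \<bullet> c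
          + 2 * p * \<beta> * (e \<bullet> x) + 2 * p * (c \<bullet> e) + 2 * \<beta> * (c \<bullet> x)" for p and c :: "real^3"
        by (simp add: inner_add_left inner_add_right inner_commute[of e x] inner_commute[of e c]
            inner_commute[of x c] power2_eq_square algebra_simps)
      show ?thesis
        unfolding power2_norm_eq_inner w_def expand cr cr2 ee a_def[symmetric] by simp
    qed
    also have "x \<bullet> x = n2 + a\<^sup>2" by (simp add: n2_def power2_norm_eq_inner)
    finally show ?thesis by (simp add: power2_eq_square algebra_simps)
  qed
  \<comment> \<open>Cyclic invariance of the triple product turns the first-order part of the
    vertical increment into the pairing of \<open>A x\<close> with \<open>dx\<close>.\<close>
  have triple: "(k *\<^sub>R e) \<bullet> cross3 dx x = cross3 x (k *\<^sub>R e) \<bullet> dx"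
    by (simp add: cross3_def inner_vec_def sum_3 algebra_simps)
  have wdx: "w \<bullet> dx = \<alpha> * (a * da) + \<beta> * y + (k *\<^sub>R e) \<bullet> cross3 dx x"
    unfolding triple by (simp add: w_def inner_add_left y_def da_def algebra_simps)
  \<comment> \<open>Only the bound on \<open>norm dx\<close> is used: Cauchy-Schwarz leaves
    \<open>- q * (norm w - L)\<^sup>2\<close>, so no derivative of the curve enters.\<close>
  have main: "- q * (norm w)\<^sup>2 + 2 * (w \<bullet> dx) - L\<^sup>2 * q \<le> 0"
  proof -
    have "w \<bullet> dx \<le> norm w * norm dx" by (rule norm_cauchy_schwarz)
    also have "\<dots> \<le> norm w * (L * q)" using dx by (intro mult_left_mono) auto
    finally have "- q * (norm w)\<^sup>2 + 2 * (w \<bullet> dx) - L\<^sup>2 * q \<le> - q * (norm w - L)\<^sup>2"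
      by (simp add: power2_eq_square algebra_simps)
    also have "\<dots> \<le> 0" using q by simp
    finally show ?thesis .
  qed
  have t1: "4 * ((k *\<^sub>R e) \<bullet> dt) \<le> 2 * ((k *\<^sub>R e) \<bullet> cross3 dx x) + 4 * k * r\<^sup>2"
  proof -
    have "(k *\<^sub>R e) \<bullet> (dt - (1/2) *\<^sub>R cross3 dx x) \<le> norm (k *\<^sub>R e) * norm (dt - (1/2) *\<^sub>R cross3 dx x)"
      by (rule norm_cauchy_schwarz)
    also have "\<dots> \<le> k * r\<^sup>2"
      using dt e \<open>k > 0\<close> by (intro mult_mono) (auto simp: r_def)
    finally show ?thesis by (simp add: inner_diff_right)
  qed
  have LrK: "K * q * (L * r) = K * r\<^sup>2" "K * q\<^sup>2 * L\<^sup>2 = K * r\<^sup>2"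
    by (simp_all add: r_def power2_eq_square)
  have t2: "(\<alpha>' - \<alpha>) * a\<^sup>2 \<le> - \<alpha>\<^sup>2 * q * a\<^sup>2 + K * r\<^sup>2"
  proof -
    have "(\<alpha>' - \<alpha> + \<alpha>\<^sup>2 * q) * a\<^sup>2 \<le> (K * q\<^sup>2) * L\<^sup>2"
      using K2(1) sq \<open>K \<ge> 0\<close> by (intro mult_mono) auto
    then show ?thesis unfolding LrK by (simp add: algebra_simps)
  qed
  have t3: "(\<beta>' - \<beta>) * n2 \<le> - (\<beta>\<^sup>2 + k\<^sup>2) * q * n2 + K * r\<^sup>2"
  proof -
    have "(\<beta>' - \<beta> + (\<beta>\<^sup>2 + k\<^sup>2) * q) * n2 \<le> (K * q\<^sup>2) * L\<^sup>2"
      using K2(2) sq \<open>K \<ge> 0\<close> by (intro mult_mono) auto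
    then show ?thesis unfolding LrK by (simp add: algebra_simps)
  qed
  have rL: "r\<^sup>2 \<le> L * r" using \<open>r \<ge> 0\<close> \<open>r \<le> L\<close> by (simp add: power2_eq_square mult_right_mono)
  have t4: "(\<alpha>' - \<alpha>) * (2 * (a * da) + da\<^sup>2) \<le> 3 * (K * r\<^sup>2)"
  proof -
    have "\<bar>2 * (a * da) + da\<^sup>2\<bar> \<le> 3 * (L * r)"
      using ada sq rL zero_le_power2[of da] unfolding abs_le_iff by linarith
    then have "\<bar>\<alpha>' - \<alpha>\<bar> * \<bar>2 * (a * da) + da\<^sup>2\<bar> \<le> (K * q) * (3 * (L * r))"
      using K1(1) \<open>K \<ge> 0\<close> q by (intro mult_mono) auto
    then have "\<bar>(\<alpha>' - \<alpha>) * (2 * (a * da) + da\<^sup>2)\<bar> \<le> 3 * (K * q * (L * r))"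
      by (simp add: abs_mult mult.left_commute mult.assoc)
    then show ?thesis using LrK by linarith
  qed
  have t5: "(\<beta>' - \<beta>) * (2 * y + dy) \<le> 5 * (K * r\<^sup>2)"
  proof -
    have "\<bar>2 * y + dy\<bar> \<le> 5 * (L * r)" using y sq rL unfolding abs_le_iff by linarith
    then have "\<bar>\<beta>' - \<beta>\<bar> * \<bar>2 * y + dy\<bar> \<le> (K * q) * (5 * (L * r))"
      using K1(2) \<open>K \<ge> 0\<close> q by (intro mult_mono) auto
    then have "\<bar>(\<beta>' - \<beta>) * (2 * y + dy)\<bar> \<le> 5 * (K * q * (L * r))"
      by (simp add: abs_mult mult.left_commute mult.assoc)
    then show ?thesis using LrK by linarith
  qed
  have t6: "\<alpha> * da\<^sup>2 \<le> K * r\<^sup>2" "\<beta> * dy \<le> K * r\<^sup>2"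
    using K0 sq \<open>K \<ge> 0\<close> by (auto intro!: mult_mono)
  have ex: "e \<bullet> (x + dx) = a + da" by (simp add: a_def da_def inner_add_right)
  have nx: "(norm (x + dx))\<^sup>2 = (norm x)\<^sup>2 + 2 * (x \<bullet> dx) + (norm dx)\<^sup>2"
    unfolding power2_norm_eq_inner by (simp add: inner_add_left inner_add_right inner_commute)
  have perp: "(norm (x + dx))\<^sup>2 - (e \<bullet> (x + dx))\<^sup>2 = n2 + (2 * y + dy)"
    unfolding ex nx n2_def y_def dy_def by (simp add: power2_eq_square algebra_simps)
  have par: "(e \<bullet> (x + dx))\<^sup>2 = a\<^sup>2 + (2 * (a * da) + da\<^sup>2)"
    unfolding ex by (simp add: power2_eq_square algebra_simps)
  have S: "(\<alpha>' * (e \<bullet> (x + dx))\<^sup>2 + \<beta>' * ((norm (x + dx))\<^sup>2 - (e \<bullet> (x + dx))\<^sup>2))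
      - (\<alpha> * (e \<bullet> x)\<^sup>2 + \<beta> * ((norm x)\<^sup>2 - (e \<bullet> x)\<^sup>2)) =
      (\<alpha>' - \<alpha>) * a\<^sup>2 + (\<beta>' - \<beta>) * n2 + (\<alpha>' - \<alpha>) * (2 * (a * da) + da\<^sup>2)
      + (\<beta>' - \<beta>) * (2 * y + dy) + \<alpha> * da\<^sup>2 + \<beta> * dy + 2 * (\<alpha> * (a * da) + \<beta> * y)"
    unfolding perp unfolding par a_def[symmetric] n2_def[symmetric] by (simp add: algebra_simps)
  have Q: "- q * (norm w)\<^sup>2 = - \<alpha>\<^sup>2 * q * a\<^sup>2 + - (\<beta>\<^sup>2 + k\<^sup>2) * q * n2"
    unfolding w2 by (simp add: algebra_simps)
  have R: "(12 * K + 4 * k) * (L * q)\<^sup>2 = 12 * (K * r\<^sup>2) + 4 * k * r\<^sup>2"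
    by (simp add: r_def algebra_simps)
  \<comment> \<open>With each nonlinear term replaced by a variable the conclusion is plain linear
    arithmetic. Here \<open>c\<close> stands for \<open>K * r\<^sup>2\<close> and \<open>b\<close>
    for \<open>4 * k * r\<^sup>2\<close>; the six error terms add up to 1 + 1 + 3 + 5 + 1 + 1 = 12
    copies of \<open>c\<close>.\<close>
  have lin: "s + t - Lq \<le> rhs"
    if "s = u1 + u2 + u3 + u4 + u5 + u6 + 2 * p" "nw = m1 + m2" "rhs = 12 * c + b" "wd = p + ct"
      "nw + 2 * wd - Lq \<le> 0" "t \<le> 2 * ct + b" "u1 \<le> m1 + c" "u2 \<le> m2 + c"
      "u3 \<le> 3 * c" "u4 \<le> 5 * c" "u5 \<le> c" "u6 \<le> c"
    for s t Lq rhs u1 u2 u3 u4 u5 u6 p nw m1 m2 c b ct wd :: real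
    using that by linarith
  show ?thesis by (rule lin[OF S Q R wdx main t1 t2 t3 t4 t5 t6])
qed

text \<open>The left-hand side is the Riccati form at time 1 plus the vertical term. At time 0 the
  form is finite thanks to \<open>\<epsilon> > 0\<close> and is evaluated at the origin, so it
  vanishes there. The bound by \<open>pi\<close> keeps the argument of the cotangent inside (0,
  \<open>pi\<close>) for all times in [0, 1].\<close>

lemma phi_regularized_le_horiz_length_sq:
  assumes hc: "horizontal_curve \<gamma> (x, t)" and e: "norm e = 1" and "k > 0"
    and "\<epsilon> > 0" and small: "k * (1 + \<epsilon>) < pi"
  shows "1 / (1 + \<epsilon>) * (e \<bullet> x)\<^sup>2 + k * cot (k * (1 + \<epsilon>)) * ((norm x)\<^sup>2 - (e \<bullet> x)\<^sup>2)
    + 4 * ((k *\<^sub>R e) \<bullet> t) \<le> (horiz_length \<gamma>)\<^sup>2"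
proof -
  obtain l where l: "continuous_on {0..1} l" "l 0 = 0" "l 1 = horiz_length \<gamma>"
    and linc: "\<And>c d. 0 \<le> c \<Longrightarrow> c \<le> d \<Longrightarrow> d \<le> 1 \<Longrightarrow> norm (fst (\<gamma> d) - fst (\<gamma> c)) \<le> l d - l c"
    and tinc: "\<And>c d. 0 \<le> c \<Longrightarrow> c \<le> d \<Longrightarrow> d \<le> 1 \<Longrightarrow>
      norm (snd (\<gamma> d) - snd (\<gamma> c) - (1/2) *\<^sub>R Ubr (fst (\<gamma> c)) (fst (\<gamma> d) - fst (\<gamma> c)))
        \<le> (l d - l c)\<^sup>2"
    using horizontal_curve_increments[OF hc] by metis
  define L where "L = l 1"
  have ends: "\<gamma> 0 = (0, 0)" "\<gamma> 1 = (x, t)"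
    using hc by (auto simp: horizontal_curve_def Nid_def)
  have mono: "l c \<le> l d" if "0 \<le> c" "c \<le> d" "d \<le> 1" for c d
    using order.trans[OF norm_ge_zero linc[OF that]] by simp
  have "L \<ge> 0" using mono[of 0 1] l(2) by (simp add: L_def)
  show ?thesis
  proof (cases "L = 0")
    \<comment> \<open>A curve of length zero admits no normalised arc length; the two increment
      estimates force its endpoint to be the identity.\<close>
    case True
    then have "x = 0" using linc[of 0 1] l ends by (simp add: L_def)
    moreover have "t = 0"
      using tinc[of 0 1] True l ends \<open>x = 0\<close> by (simp add: L_def Ubr_eq_cross3)
    ultimately show ?thesis by simp
  next
    case False
    with \<open>L \<ge> 0\<close> have "L > 0" by simp
    \<comment> \<open>These are the solutions of \<open>m' = - (m\<^sup>2 + c)\<close> with a pole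
      at \<open>- \<epsilon>\<close>, for \<open>c = 0\<close> and for
      \<open>c = k\<^sup>2\<close>.\<close>
    define \<alpha> where "\<alpha> = (\<lambda>s. 1 / (s + \<epsilon>))"
    define \<beta> where "\<beta> = (\<lambda>s. k * cot (k * (s + \<epsilon>)))"
    have da: "(\<alpha> has_real_derivative - ((\<alpha> s)\<^sup>2 + 0)) (at s)" if "s \<in> {0..1}" for s
      using that \<open>\<epsilon> > 0\<close> unfolding \<alpha>_def
      by (auto intro!: derivative_eq_intros simp: power2_eq_square)
    have db: "(\<beta> has_real_derivative - ((\<beta> s)\<^sup>2 + k\<^sup>2)) (at s)" if "s \<in> {0..1}" for s
    proof -
      have "k * (s + \<epsilon>) \<le> k * (1 + \<epsilon>)" using that \<open>k > 0\<close> by (intro mult_left_mono) auto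
      moreover have "0 < k * (s + \<epsilon>)" using that \<open>k > 0\<close> \<open>\<epsilon> > 0\<close> by (intro mult_pos_pos) auto
      ultimately have sn: "sin (k * (s + \<epsilon>)) \<noteq> 0" using small sin_gt_zero by fastforce
      have "(\<beta> has_real_derivative k * (- inverse ((sin (k * (s + \<epsilon>)))\<^sup>2) * k)) (at s)"
        unfolding \<beta>_def
        by (rule DERIV_cmult, rule DERIV_chain2[where g = "\<lambda>s. k * (s + \<epsilon>)", OF DERIV_cot[OF sn]])
          (auto intro!: derivative_eq_intros)
      moreover have "inverse ((sin (k * (s + \<epsilon>)))\<^sup>2) = 1 + (cot (k * (s + \<epsilon>)))\<^sup>2"
        using sn sin_cos_squared_add[of "k * (s + \<epsilon>)"] by (simp add: cot_def field_simps)
      ultimately show ?thesis by (simp add: \<beta>_def power2_eq_square algebra_simps)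
    qed
    obtain Ka where Ka: "Ka \<ge> 0" "\<And>u. 0 \<le> u \<Longrightarrow> u \<le> 1 \<Longrightarrow> \<bar>\<alpha> u\<bar> \<le> Ka"
      "\<And>u v. 0 \<le> u \<Longrightarrow> u \<le> v \<Longrightarrow> v \<le> 1 \<Longrightarrow> \<bar>\<alpha> v - \<alpha> u\<bar> \<le> Ka * (v - u)"
      "\<And>u v. 0 \<le> u \<Longrightarrow> u \<le> v \<Longrightarrow> v \<le> 1 \<Longrightarrow> \<bar>\<alpha> v - \<alpha> u + ((\<alpha> u)\<^sup>2 + 0) * (v - u)\<bar> \<le> Ka * (v - u)\<^sup>2"
      using riccati_increment_bounds[OF da order_refl] by metis
    obtain Kb where Kb: "Kb \<ge> 0" "\<And>u. 0 \<le> u \<Longrightarrow> u \<le> 1 \<Longrightarrow> \<bar>\<beta> u\<bar> \<le> Kb"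
      "\<And>u v. 0 \<le> u \<Longrightarrow> u \<le> v \<Longrightarrow> v \<le> 1 \<Longrightarrow> \<bar>\<beta> v - \<beta> u\<bar> \<le> Kb * (v - u)"
      "\<And>u v. 0 \<le> u \<Longrightarrow> u \<le> v \<Longrightarrow> v \<le> 1 \<Longrightarrow>
        \<bar>\<beta> v - \<beta> u + ((\<beta> u)\<^sup>2 + k\<^sup>2) * (v - u)\<bar> \<le> Kb * (v - u)\<^sup>2"
      using riccati_increment_bounds[OF db zero_le_power2] by metis
    define K where "K = Ka + Kb"
    \<comment> \<open>The normalised arc length \<open>\<sigma>\<close> serves as the time of the
      Riccati solutions along the original parametrisation; accordingly \<open>L * l s\<close> is
      \<open>L\<^sup>2 * \<sigma> s\<close>.\<close>
    define X T \<sigma> where "X = (\<lambda>s. fst (\<gamma> s))" and "T = (\<lambda>s. snd (\<gamma> s))" and "\<sigma> = (\<lambda>s. l s / L)"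
    define F where "F = (\<lambda>s. \<alpha> (\<sigma> s) * (e \<bullet> X s)\<^sup>2 + \<beta> (\<sigma> s) * ((norm (X s))\<^sup>2 - (e \<bullet> X s)\<^sup>2)
      + 4 * ((k *\<^sub>R e) \<bullet> T s) - L * l s)"
    have "F 1 \<le> F 0"
    proof (rule quadratic_increments_imp_le[OF l(1) mono])
      fix c d :: real assume cd: "0 \<le> c" "c \<le> d" "d \<le> 1"
      define q where "q = \<sigma> d - \<sigma> c"
      have Lq: "L * q = l d - l c" using \<open>L > 0\<close> by (simp add: q_def \<sigma>_def field_simps)
      have \<sigma>: "0 \<le> \<sigma> c" "\<sigma> c \<le> \<sigma> d" "\<sigma> d \<le> 1"
        using mono[of 0 c] mono[OF cd] mono[of d 1] cd l(2) \<open>L > 0\<close>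
        by (auto simp: \<sigma>_def L_def divide_right_mono)
      have q: "0 \<le> q" "q \<le> 1" using \<sigma> by (auto simp: q_def)
      have Kle: "Ka * z \<le> K * z" "Kb * z \<le> K * z" if "z \<ge> 0" for z
        using Ka(1) Kb(1) that by (auto simp: K_def distrib_right)
      have "(\<alpha> (\<sigma> d) * (e \<bullet> (X c + (X d - X c)))\<^sup>2
          + \<beta> (\<sigma> d) * ((norm (X c + (X d - X c)))\<^sup>2 - (e \<bullet> (X c + (X d - X c)))\<^sup>2))
        - (\<alpha> (\<sigma> c) * (e \<bullet> X c)\<^sup>2 + \<beta> (\<sigma> c) * ((norm (X c))\<^sup>2 - (e \<bullet> X c)\<^sup>2))
        + 4 * ((k *\<^sub>R e) \<bullet> (T d - T c)) - L\<^sup>2 * q \<le> (12 * K + 4 * k) * (L * q)\<^sup>2"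
      proof (rule riccati_step_estimate[OF e \<open>k > 0\<close> \<open>L \<ge> 0\<close> _ q])
        show "K \<ge> 0" using Ka(1) Kb(1) by (simp add: K_def)
        show "norm (X c) \<le> L"
          using linc[of 0 c] mono[of c 1] cd l(2) ends by (simp add: X_def L_def)
        show "norm (X d - X c) \<le> L * q" using linc[OF cd] by (simp add: Lq X_def)
        show "\<bar>\<alpha> (\<sigma> c)\<bar> \<le> K" "\<bar>\<beta> (\<sigma> c)\<bar> \<le> K"
          using Ka(1) Kb(1) Ka(2)[of "\<sigma> c"] Kb(2)[of "\<sigma> c"] \<sigma> by (auto simp: K_def)
        show "\<bar>\<alpha> (\<sigma> d) - \<alpha> (\<sigma> c)\<bar> \<le> K * q" "\<bar>\<beta> (\<sigma> d) - \<beta> (\<sigma> c)\<bar> \<le> K * q"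
          using Ka(3)[OF \<sigma>] Kb(3)[OF \<sigma>] Kle[OF q(1)] by (auto simp: q_def)
        show "\<bar>\<alpha> (\<sigma> d) - \<alpha> (\<sigma> c) + (\<alpha> (\<sigma> c))\<^sup>2 * q\<bar> \<le> K * q\<^sup>2"
          "\<bar>\<beta> (\<sigma> d) - \<beta> (\<sigma> c) + ((\<beta> (\<sigma> c))\<^sup>2 + k\<^sup>2) * q\<bar> \<le> K * q\<^sup>2"
          using Ka(4)[OF \<sigma>] Kb(4)[OF \<sigma>] Kle[of "q\<^sup>2"] by (auto simp: q_def)
        show "norm (T d - T c - (1/2) *\<^sub>R cross3 (X d - X c) (X c)) \<le> (L * q)\<^sup>2"
          using tinc[OF cd] by (simp add: Lq X_def T_def Ubr_eq_cross3)
      qed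
      moreover have "L\<^sup>2 * q = L * l d - L * l c"
        using Lq by (metis mult.assoc power2_eq_square right_diff_distrib)
      ultimately show "F d - F c \<le> (12 * K + 4 * k) * (l d - l c)\<^sup>2"
        unfolding F_def Lq by (simp add: inner_diff_right algebra_simps)
    qed
    moreover have "F 0 = 0" using ends l(2) by (simp add: F_def X_def T_def)
    moreover have "F 1 = 1 / (1 + \<epsilon>) * (e \<bullet> x)\<^sup>2 + k * cot (k * (1 + \<epsilon>)) * ((norm x)\<^sup>2 - (e \<bullet> x)\<^sup>2)
        + 4 * ((k *\<^sub>R e) \<bullet> t) - (horiz_length \<gamma>)\<^sup>2"
      using ends l(3) \<open>L > 0\<close>
      by (simp add: F_def X_def T_def \<sigma>_def L_def[symmetric] \<alpha>_def \<beta>_def power2_eq_square)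
    ultimately show ?thesis by linarith
  qed
qed

text \<open>The regularised form is continuous at \<open>\<epsilon> = 0\<close> because
  \<open>sin k\<close> is nonzero for \<open>k\<close> strictly between 0 and \<open>pi\<close>, so
  the bound passes to the limit from the right.\<close>

theorem phi_le_horiz_length_sq:
  assumes hc: "horizontal_curve \<gamma> (x, t)" and "\<theta> \<noteq> 0" "norm \<theta> < pi"
  shows "phi (x, t) \<theta> \<le> (horiz_length \<gamma>)\<^sup>2"
proof -
  define k where "k = norm \<theta>"
  define e where "e = \<theta> /\<^sub>R k"
  have k: "k > 0" "k < pi" using assms by (auto simp: k_def)
  have e: "norm e = 1" and \<theta>: "\<theta> = k *\<^sub>R e"
    using \<open>\<theta> \<noteq> 0\<close> by (auto simp: e_def k_def)
  have sk: "sin k \<noteq> 0" using sin_gt_zero k by fastforce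
  define G where "G = (\<lambda>\<epsilon>. 1 / (1 + \<epsilon>) * (e \<bullet> x)\<^sup>2
    + k * cot (k * (1 + \<epsilon>)) * ((norm x)\<^sup>2 - (e \<bullet> x)\<^sup>2) + 4 * ((k *\<^sub>R e) \<bullet> t))"
  have "isCont G 0"
    unfolding G_def cot_def using sk by (intro continuous_intros) auto
  then have "(G \<longlongrightarrow> G 0) (at_right 0)"
    using isCont_def tendsto_within_subset by (metis subset_UNIV)
  moreover have "\<forall>\<^sub>F \<epsilon> in at_right 0. G \<epsilon> \<le> (horiz_length \<gamma>)\<^sup>2"
  proof (rule eventually_at_rightI[of 0 "pi / k - 1"])
    show "0 < pi / k - 1" using k by (simp add: field_simps)
    fix \<epsilon> assume "\<epsilon> \<in> {0<..<pi / k - 1}"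
    then have "\<epsilon> > 0" "k * (1 + \<epsilon>) < pi" using k by (auto simp: field_simps)
    then show "G \<epsilon> \<le> (horiz_length \<gamma>)\<^sup>2"
      unfolding G_def using phi_regularized_le_horiz_length_sq[OF hc e k(1)] by blast
  qed
  ultimately have "G 0 \<le> (horiz_length \<gamma>)\<^sup>2"
    by (rule tendsto_upperbound) simp
  \<comment> \<open>For the unit vector \<open>e\<close> the term
    \<open>psi k * (\<theta> \<bullet> x)\<^sup>2\<close> equals
    \<open>(1 - k * cot k) * (e \<bullet> x)\<^sup>2\<close>. Thus \<open>phi\<close> has the factor
    1 along \<open>e\<close> and \<open>k * cot k\<close> on the complement, which are the limits of
    the Riccati coefficients.\<close>
  moreover have "phi (x, t) \<theta> = G 0"
    using k e unfolding \<theta> by (simp add: phi_def G_def scot_def psi_def inner_commute[of t]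
        power2_eq_square field_simps)
  ultimately show ?thesis by simp
qed

section \<open>The extremal helix\<close>

lemma abs_cont_on_lipschitz:
  assumes lip: "\<And>u v. a \<le> u \<Longrightarrow> u \<le> v \<Longrightarrow> v \<le> b \<Longrightarrow> norm (f v - f u) \<le> B * (v - u)" and "B \<ge> 0"
  shows "abs_cont_on a b f"
  unfolding abs_cont_on_def
proof (intro allI impI)
  fix \<epsilon> :: real assume "\<epsilon> > 0"
  show "\<exists>\<delta>>0. \<forall>(n::nat) (I::nat \<Rightarrow> real \<times> real).
        (\<forall>i<n. a \<le> fst (I i) \<and> fst (I i) \<le> snd (I i) \<and> snd (I i) \<le> b) \<and>
        (\<forall>i<n. \<forall>j<n. i \<noteq> j \<longrightarrow> snd (I i) \<le> fst (I j) \<or> snd (I j) \<le> fst (I i)) \<and>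
        (\<Sum>i<n. snd (I i) - fst (I i)) < \<delta>
        \<longrightarrow> (\<Sum>i<n. norm (f (snd (I i)) - f (fst (I i)))) < \<epsilon>"
  proof (intro exI[of _ "\<epsilon> / (B + 1)"] conjI allI impI)
    show "\<epsilon> / (B + 1) > 0" using \<open>\<epsilon> > 0\<close> \<open>B \<ge> 0\<close> by simp
    fix n :: nat and I :: "nat \<Rightarrow> real \<times> real"
    assume I: "(\<forall>i<n. a \<le> fst (I i) \<and> fst (I i) \<le> snd (I i) \<and> snd (I i) \<le> b) \<and>
        (\<forall>i<n. \<forall>j<n. i \<noteq> j \<longrightarrow> snd (I i) \<le> fst (I j) \<or> snd (I j) \<le> fst (I i)) \<and>
        (\<Sum>i<n. snd (I i) - fst (I i)) < \<epsilon> / (B + 1)"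
    have "(\<Sum>i<n. norm (f (snd (I i)) - f (fst (I i)))) \<le> (\<Sum>i<n. B * (snd (I i) - fst (I i)))"
      using I lip by (intro sum_mono) auto
    also have "\<dots> = B * (\<Sum>i<n. snd (I i) - fst (I i))" by (simp add: sum_distrib_left)
    also have "\<dots> \<le> B * (\<epsilon> / (B + 1))" using I \<open>B \<ge> 0\<close> by (intro mult_left_mono) auto
    also have "\<dots> < \<epsilon>" using \<open>\<epsilon> > 0\<close> \<open>B \<ge> 0\<close> by (simp add: field_simps)
    finally show "(\<Sum>i<n. norm (f (snd (I i)) - f (fst (I i)))) < \<epsilon>" .
  qed
qed

text \<open>A continuous velocity is bounded on the compact parameter interval, so the curve is
  Lipschitz and hence absolutely continuous; the length is the integral of a constant.\<close>

lemma horizontal_curve_constant_speed: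
  assumes der: "\<And>s. (\<gamma> has_vector_derivative v s) (at s)" and cont: "continuous_on {0..1} v"
    and hor: "\<And>s. snd (v s) = (1/2) *\<^sub>R Ubr (fst (\<gamma> s)) (fst (v s))"
    and ends: "\<gamma> 0 = Nid" "\<gamma> 1 = g" and speed: "\<And>s. norm (fst (v s)) = V"
  shows "horizontal_curve \<gamma> g" "horiz_length \<gamma> = V"
proof -
  have vd: "vector_derivative \<gamma> (at s) = v s" for s
    using der by (rule vector_derivative_at)
  have "compact (v ` {0..1})" using cont by (intro compact_continuous_image) auto
  then obtain B where "B > 0" and B: "\<And>s. s \<in> {0..1} \<Longrightarrow> norm (v s) \<le> B"
    using compact_imp_bounded bounded_pos by (metis imageI)
  have "abs_cont_on 0 1 \<gamma>"
  proof (rule abs_cont_on_lipschitz[where B = B])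
    fix c d :: real assume cd: "0 \<le> c" "c \<le> d" "d \<le> 1"
    have "norm (\<gamma> d - \<gamma> c) \<le> B * norm (d - c)"
    proof (rule differentiable_bound[where S = "{0..1}" and f' = "\<lambda>s h. h *\<^sub>R v s"])
      fix s :: real assume s: "s \<in> {0..1}"
      show "(\<gamma> has_derivative (\<lambda>h. h *\<^sub>R v s)) (at s within {0..1})"
        using der[of s] by (auto simp: has_vector_derivative_def intro: has_derivative_at_withinI)
      show "onorm (\<lambda>h. h *\<^sub>R v s) \<le> B"
        using mult_right_mono[OF B[OF s] abs_ge_zero] by (intro onorm_le) (simp add: mult.commute)
    qed (use cd in auto)
    then show "norm (\<gamma> d - \<gamma> c) \<le> B * (d - c)" using cd by simp
  qed (use \<open>B > 0\<close> in simp)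
  then show "horizontal_curve \<gamma> g"
    using ends hor der by (auto simp: horizontal_curve_def vd intro: differentiableI_vector)
  show "horiz_length \<gamma> = V"
    by (simp add: horiz_length_def vd speed set_lebesgue_integral_def)
qed

text \<open>The basis \<open>(c, d, 0)\<close>, \<open>(d, -c, 0)\<close>, \<open>(0, 0, 1)\<close> is left-handed, which absorbs the sign in
  \<open>Ubr x x' = - x \<times> x'\<close>.\<close>

definition frame :: "real \<Rightarrow> real \<Rightarrow> real \<Rightarrow> real \<Rightarrow> real \<Rightarrow> real^3" where
  "frame c d y1 y2 y3 = vector [c * y1 + d * y2, d * y1 - c * y2, y3]"

lemma frame_components [simp]:
  "frame c d y1 y2 y3 $ 1 = c * y1 + d * y2" "frame c d y1 y2 y3 $ 2 = d * y1 - c * y2"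
  "frame c d y1 y2 y3 $ 3 = y3"
  by (simp_all add: frame_def)

lemma has_vector_derivative_vec3:
  fixes f :: "real \<Rightarrow> real^3"
  assumes "((\<lambda>s. f s $ 1) has_real_derivative v $ 1) (at s)"
    "((\<lambda>s. f s $ 2) has_real_derivative v $ 2) (at s)"
    "((\<lambda>s. f s $ 3) has_real_derivative v $ 3) (at s)"
  shows "(f has_vector_derivative v) (at s)"
proof -
  have "((\<lambda>s. f s $ i) has_vector_derivative v $ i) (at s)" for i
    using assms exhaust_3[of i] by (auto simp: has_real_derivative_iff_has_vector_derivative)
  then show ?thesis
    unfolding has_vector_derivative_def has_derivative_componentwise_within[of f]
    by (auto simp: Basis_vec_def inner_axis)
qed

lemma has_vector_derivative_frame:
  assumes "(y1 has_real_derivative z1) (at s)" "(y2 has_real_derivative z2) (at s)"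
    "(y3 has_real_derivative z3) (at s)"
  shows "((\<lambda>s. frame c d (y1 s) (y2 s) (y3 s)) has_vector_derivative frame c d z1 z2 z3) (at s)"
  by (rule has_vector_derivative_vec3) (auto intro!: derivative_eq_intros assms)

lemma continuous_on_frame:
  fixes S :: "'a::t2_space set"
  assumes "continuous_on S y1" "continuous_on S y2" "continuous_on S y3"
  shows "continuous_on S (\<lambda>s. frame c d (y1 s) (y2 s) (y3 s))"
  unfolding continuous_on_componentwise[of S "\<lambda>s. frame c d (y1 s) (y2 s) (y3 s)"]
proof
  fix b :: "real^3" assume "b \<in> Basis"
  then obtain i where b: "b = axis i 1" by (auto simp: Basis_vec_def)
  from exhaust_3[of i] show "continuous_on S (\<lambda>s. frame c d (y1 s) (y2 s) (y3 s) \<bullet> b)"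
    unfolding b inner_axis
    by (elim disjE; simp add: assms continuous_on_add continuous_on_diff continuous_on_mult)
qed

lemma norm_frame:
  assumes "c\<^sup>2 + d\<^sup>2 = 1"
  shows "norm (frame c d y1 y2 y3) = sqrt (y1\<^sup>2 + y2\<^sup>2 + y3\<^sup>2)"
proof -
  have "(c * y1 + d * y2)\<^sup>2 + (d * y1 - c * y2)\<^sup>2 = (c\<^sup>2 + d\<^sup>2) * (y1\<^sup>2 + y2\<^sup>2)"
    by (simp add: power2_eq_square algebra_simps)
  then show ?thesis using assms by (simp add: norm_vec_def L2_set_def sum_3)
qed

lemma Ubr_frame:
  assumes "c\<^sup>2 + d\<^sup>2 = 1"
  shows "Ubr (frame c d y1 y2 y3) (frame c d z1 z2 z3) =
    frame c d (y2 * z3 - y3 * z2) (y3 * z1 - y1 * z3) (y1 * z2 - y2 * z1)"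
proof -
  have "(d * y1 - c * y2) * (c * z1 + d * z2) - (d * z1 - c * z2) * (c * y1 + d * y2)
      = (c\<^sup>2 + d\<^sup>2) * (y1 * z2 - y2 * z1)"
    by (simp add: power2_eq_square algebra_simps)
  then show ?thesis using assms
    by (simp add: Ubr_eq_cross3 cross3_def vec_eq_iff forall_3 algebra_simps)
qed

text \<open>The horizontal part advances by \<open>b\<close> along the first frame vector and turns
  through the angle \<open>2 * k\<close> on a circle of radius \<open>R\<close> in the plane of the
  other two. The first vertical coordinate of the endpoint,
  \<open>R\<^sup>2 * (k - sin k * cos k)\<close>, is the signed area swept in that plane, the area
  of a circular segment of half-angle \<open>k\<close>.\<close>

lemma helix_horizontal_curve:
  fixes b c d k R :: real
  assumes cd: "c\<^sup>2 + d\<^sup>2 = 1" and "k \<noteq> 0"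
  shows "\<exists>\<gamma>. horizontal_curve \<gamma> (frame c d b (2 * R * sin k) 0,
      frame c d (R\<^sup>2 * (k - sin k * cos k)) (R * b * (cos k - sin k / k)) 0)
    \<and> horiz_length \<gamma> = sqrt (b\<^sup>2 + (2 * k * R)\<^sup>2)"
proof -
  \<comment> \<open>The angle runs from \<open>- k\<close> to \<open>k\<close>, symmetrically about
    the midpoint, so the chord of the arc points along the second frame vector and the third
    coordinates of both endpoint components vanish.\<close>
  define S C where "S = (\<lambda>s::real. sin (k * (2 * s - 1)))" and "C = (\<lambda>s::real. cos (k * (2 * s - 1)))"
  define y1 y2 y3 where "y1 = (\<lambda>s. b * s)" and "y2 = (\<lambda>s. R * (S s + sin k))"
    and "y3 = (\<lambda>s. R * (cos k - C s))"
  define z1 z2 z3 where "z1 = (\<lambda>s::real. b)" and "z2 = (\<lambda>s. 2 * k * R * C s)"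
    and "z3 = (\<lambda>s. 2 * k * R * S s)"
  \<comment> \<open>Explicit antiderivatives of the half brackets, with constants chosen so that all
    three vanish at \<open>s = 0\<close>.\<close>
  define t1 t2 t3 where "t1 = (\<lambda>s. R\<^sup>2 * (k * s - sin (2 * k * s) / 2))"
    and "t2 = (\<lambda>s. R * b / 2 * (cos k * s + s * C s - (S s + sin k) / k))"
    and "t3 = (\<lambda>s. R * b / 2 * (s * S s + (C s - cos k) / k - sin k * s))"
  define \<gamma> where "\<gamma> = (\<lambda>s. (frame c d (y1 s) (y2 s) (y3 s), frame c d (t1 s) (t2 s) (t3 s)))"
  define u where "u = (\<lambda>s. frame c d ((y2 s * z3 s - y3 s * z2 s) / 2) ((y3 s * z1 s - y1 s * z3 s) / 2)
    ((y1 s * z2 s - y2 s * z1 s) / 2))"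
  define v where "v = (\<lambda>s. (frame c d (z1 s) (z2 s) (z3 s), u s))"
  have dS: "(S has_real_derivative 2 * k * C s) (at s)"
    and dC: "(C has_real_derivative - (2 * k * S s)) (at s)" for s
    unfolding S_def C_def by (auto intro!: derivative_eq_intros)
  have SC: "S s * S s + C s * C s = 1" for s
    using sin_cos_squared_add[of "k * (2 * s - 1)"] by (simp add: S_def C_def power2_eq_square)
  have cosadd: "cos (2 * k * s) = C s * cos k - S s * sin k" for s
  proof -
    have "2 * k * s = k * (2 * s - 1) + k" by (simp add: algebra_simps)
    then show ?thesis unfolding S_def C_def by (simp only: cos_add)
  qed
  have d1: "(t1 has_real_derivative (y2 s * z3 s - y3 s * z2 s) / 2) (at s)" for s
  proof -
    have "(t1 has_real_derivative R\<^sup>2 * (k - k * cos (2 * k * s))) (at s)"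
      unfolding t1_def by (auto intro!: derivative_eq_intros)
    moreover have "R\<^sup>2 * (k - k * cos (2 * k * s)) = (y2 s * z3 s - y3 s * z2 s) / 2"
    proof -
      have "(y2 s * z3 s - y3 s * z2 s) / 2
          = k * R\<^sup>2 * ((S s * S s + C s * C s) + sin k * S s - cos k * C s)"
        by (simp add: y2_def y3_def z2_def z3_def power2_eq_square field_simps)
      also have "\<dots> = R\<^sup>2 * (k - k * cos (2 * k * s))"
        unfolding SC cosadd by (simp add: algebra_simps)
      finally show ?thesis by (rule sym)
    qed
    ultimately show ?thesis by simp
  qed
  have d2: "(t2 has_real_derivative (y3 s * z1 s - y1 s * z3 s) / 2) (at s)" for s
    unfolding t2_def using \<open>k \<noteq> 0\<close>
    by (auto intro!: derivative_eq_intros dS dC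
        simp: y1_def y3_def z1_def z3_def field_simps)
  have d3: "(t3 has_real_derivative (y1 s * z2 s - y2 s * z1 s) / 2) (at s)" for s
    unfolding t3_def using \<open>k \<noteq> 0\<close>
    by (auto intro!: derivative_eq_intros dS dC
        simp: y1_def y2_def z1_def z2_def field_simps)
  have "(\<gamma> has_vector_derivative v s) (at s)" for s
    unfolding \<gamma>_def v_def u_def
  proof (intro has_vector_derivative_Pair has_vector_derivative_frame d1 d2 d3)
    show "(y1 has_real_derivative z1 s) (at s)" unfolding y1_def z1_def
      by (auto intro!: derivative_eq_intros)
    show "(y2 has_real_derivative z2 s) (at s)" unfolding y2_def z2_def
      by (auto intro!: derivative_eq_intros dS)
    show "(y3 has_real_derivative z3 s) (at s)" unfolding y3_def z3_def
      by (auto intro!: derivative_eq_intros dC)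
  qed
  moreover have "continuous_on {0..1} v"
    unfolding v_def u_def y1_def y2_def y3_def z1_def z2_def z3_def S_def C_def
    by (intro continuous_on_Pair continuous_on_frame continuous_intros) auto
  moreover have "snd (v s) = (1/2) *\<^sub>R Ubr (fst (\<gamma> s)) (fst (v s))" for s
    unfolding v_def \<gamma>_def u_def fst_conv snd_conv Ubr_frame[OF cd]
    by (simp add: vec_eq_iff forall_3 field_simps)
  moreover have "\<gamma> 0 = Nid"
    by (simp add: \<gamma>_def Nid_def y1_def y2_def y3_def t1_def t2_def t3_def S_def C_def vec_eq_iff forall_3)
  moreover have "\<gamma> 1 = (frame c d b (2 * R * sin k) 0,
      frame c d (R\<^sup>2 * (k - sin k * cos k)) (R * b * (cos k - sin k / k)) 0)"
  proof -
    have "y1 1 = b" "y2 1 = 2 * R * sin k" "y3 1 = 0" "t3 1 = 0"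
      by (simp_all add: y1_def y2_def y3_def t3_def S_def C_def)
    moreover have "t1 1 = R\<^sup>2 * (k - sin k * cos k)" by (simp add: t1_def sin_double)
    moreover have "t2 1 = R * b * (cos k - sin k / k)" by (simp add: t2_def S_def C_def field_simps)
    ultimately show ?thesis by (simp add: \<gamma>_def)
  qed
  moreover have "norm (fst (v s)) = sqrt (b\<^sup>2 + (2 * k * R)\<^sup>2)" for s
  proof -
    have "(z2 s)\<^sup>2 + (z3 s)\<^sup>2 = (2 * k * R)\<^sup>2 * (S s * S s + C s * C s)"
      by (simp add: z2_def z3_def power2_eq_square algebra_simps)
    then show ?thesis unfolding v_def fst_conv norm_frame[OF cd] SC z1_def by (simp add: add.assoc)
  qed
  ultimately show ?thesis using horizontal_curve_constant_speed[of \<gamma> v] by blast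
qed

section \<open>Functional calculus of the structure matrix\<close>

lemma norm_vec3_sq: "(norm (\<theta>::real^3))\<^sup>2 = (\<theta>$1)\<^sup>2 + (\<theta>$2)\<^sup>2 + (\<theta>$3)\<^sup>2"
  unfolding power2_norm_eq_inner by (simp add: inner_vec_def sum_3 power2_eq_square)

lemma Umat_mult_components:
  "(Umat \<theta> *v v) $ 1 = \<i> * (of_real (\<theta>$3) * v$2 - of_real (\<theta>$2) * v$3)"
  "(Umat \<theta> *v v) $ 2 = \<i> * (of_real (\<theta>$1) * v$3 - of_real (\<theta>$3) * v$1)"
  "(Umat \<theta> *v v) $ 3 = \<i> * (of_real (\<theta>$2) * v$1 - of_real (\<theta>$1) * v$2)"
  by (simp_all add: Umat_def Uskew_def matrix_vector_mult_def sum_3 algebra_simps)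

text \<open>This is the Cayley-Hamilton identity: the eigenvalues are 0 and plus or minus the norm
  of \<open>\<theta>\<close>.\<close>

lemma Umat_cube:
  "Umat \<theta> *v (Umat \<theta> *v (Umat \<theta> *v v)) = of_real ((norm \<theta>)\<^sup>2) *s (Umat \<theta> *v v)"
  unfolding norm_vec3_sq
  by (simp add: vec_eq_iff forall_3 Umat_mult_components power2_eq_square algebra_simps)

text \<open>An even \<open>f\<close> agrees on the three eigenvalues with a polynomial of the form
  \<open>f 0 + q * z\<^sup>2\<close>, so that polynomial in \<open>Umat \<theta>\<close> satisfies
  the defining property of \<open>matfun\<close>. Uniqueness, needed for the definite description,
  holds because every vector is a sum of eigenvectors.\<close>

lemma matfun_Umat:
  fixes v :: "complex^3"
  assumes "\<theta> \<noteq> 0" and even: "f (- of_real (norm \<theta>)) = f (of_real (norm \<theta>))"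
  shows "matfun f (Umat \<theta>) *v v =
    f 0 *s v + ((f (of_real (norm \<theta>)) - f 0) / of_real ((norm \<theta>)\<^sup>2)) *s (Umat \<theta> *v (Umat \<theta> *v v))"
proof -
  define k where "k = complex_of_real (norm \<theta>)"
  have "k \<noteq> 0" using assms(1) by (simp add: k_def)
  define h where "h = (\<lambda>v. Umat \<theta> *v v)"
  have h_add: "h (u + w) = h u + h w" and h_diff: "h (u - w) = h u - h w"
    and h_smult: "h (c *s u) = c *s h u" for u w c
    by (simp_all add: h_def matrix_vector_right_distrib matrix_vector_mult_diff_distrib
        vector_scalar_commute)
  have cube: "h (h (h v)) = k\<^sup>2 *s h v" for v
    using Umat_cube[of \<theta> v] by (simp add: h_def k_def)
  define q where "q = (f k - f 0) / k\<^sup>2"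
  define M where "M = (\<chi> i j. (if i = j then f 0 else 0) + q * (Umat \<theta> ** Umat \<theta>) $ i $ j)"
  have M: "M *v v = f 0 *s v + q *s h (h v)" for v
  proof -
    have "M *v v = f 0 *s v + q *s ((Umat \<theta> ** Umat \<theta>) *v v)"
      by (simp add: M_def vec_eq_iff forall_3 matrix_vector_mult_def sum_3 algebra_simps)
    then show ?thesis by (simp add: h_def matrix_vector_mul_assoc)
  qed
  have "matfun f (Umat \<theta>) = M"
    unfolding matfun_def
  proof (rule the_equality)
    show "\<forall>c v. Umat \<theta> *v v = c *s v \<longrightarrow> M *v v = f c *s v"
    proof (intro allI impI)
      fix c v assume eig: "Umat \<theta> *v v = c *s v"
      then have hv: "h v = c *s v" by (simp add: h_def)
      show "M *v v = f c *s v"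
      proof (cases "v = 0")
        case True
        then show ?thesis by simp
      next
        case False
        \<comment> \<open>The cubic identity on a nonzero eigenvector confines the eigenvalue to 0,
          \<open>k\<close> and \<open>- k\<close>.\<close>
        have "(c * (c * c)) *s v = (k\<^sup>2 * c) *s v"
          using cube[of v] by (simp add: hv h_smult vector_smult_assoc)
        then have "c * (c * c) = k\<^sup>2 * c" using False by (metis vector_mul_rcancel)
        then have "c = 0 \<or> c\<^sup>2 = k\<^sup>2" by (auto simp: power2_eq_square)
        then have c: "c = 0 \<or> c = k \<or> c = - k" by (simp add: power2_eq_iff)
        have "M *v v = (f 0 + q * c\<^sup>2) *s v"
          unfolding M by (simp add: hv h_smult vector_smult_assoc vector_sadd_rdistrib power2_eq_square)
        moreover have "f 0 + q * c\<^sup>2 = f c"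
          using c even \<open>k \<noteq> 0\<close> by (auto simp: q_def k_def)
        ultimately show ?thesis by simp
      qed
    qed
  next
    fix M' assume M': "\<forall>c v. Umat \<theta> *v v = c *s v \<longrightarrow> M' *v v = f c *s v"
    have M'h: "M' *v v = f c *s v" if "h v = c *s v" for c v
      using M' that by (simp add: h_def)
    have "M' *v v = M *v v" for v
    proof -
      \<comment> \<open>The components of \<open>v\<close> in the eigenspaces for 0,
        \<open>k\<close> and \<open>- k\<close>, given by the spectral projections as polynomials in
        \<open>Umat \<theta>\<close>.\<close>
      define a b c where "a = v - (1/k\<^sup>2) *s h (h v)"
        and "b = (1/(2*k\<^sup>2)) *s (h (h v) + k *s h v)" and "c = (1/(2*k\<^sup>2)) *s (h (h v) - k *s h v)"
      have v: "v = a + b + c"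
        using \<open>k \<noteq> 0\<close> by (simp add: a_def b_def c_def vec_eq_iff field_simps)
      have "h a = 0 *s a"
        using \<open>k \<noteq> 0\<close> by (simp add: a_def h_diff h_smult cube vector_smult_assoc)
      moreover have "h b = k *s b"
        by (simp add: b_def h_add h_smult cube vec_eq_iff power2_eq_square algebra_simps)
      moreover have "h c = (- k) *s c"
        by (simp add: c_def h_diff h_smult cube vec_eq_iff power2_eq_square algebra_simps)
      ultimately have "M' *v v = f 0 *s a + f k *s b + f (- k) *s c"
        unfolding v matrix_vector_right_distrib using M'h by metis
      also have "\<dots> = M *v v"
        unfolding M using \<open>k \<noteq> 0\<close> even
        by (simp add: k_def[symmetric] a_def b_def c_def q_def vec_eq_iff field_simps)
      finally show ?thesis .
    qed
    then show "M' = M" by (simp add: matrix_eq)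
  qed
  then show ?thesis using M by (simp add: q_def k_def h_def)
qed

lemma norm_matfun_sdivsin_Umat:
  fixes \<theta> :: "real^3"
  assumes "\<theta> $ 3 = 0" "\<theta> \<noteq> 0" "sin (norm \<theta>) \<noteq> 0" and x: "x = N *\<^sub>R axis 1 1"
  shows "(norm (matfun sdivsin (Umat \<theta>) *v (\<chi> i. complex_of_real (x $ i))))\<^sup>2
    = N\<^sup>2 * ((\<theta> $ 1)\<^sup>2 / (norm \<theta>)\<^sup>2 + (\<theta> $ 2 / sin (norm \<theta>))\<^sup>2)"
proof -
  define k p q where "k = norm \<theta>" and "p = \<theta> $ 1" and "q = \<theta> $ 2"
  \<comment> \<open>The coefficient of the squared matrix in the interpolating polynomial of
    \<open>sdivsin\<close>. It satisfies \<open>1 + c * k\<^sup>2 = k / sin k\<close>, which makes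
    the norm below collapse.\<close>
  define c where "c = (k / sin k - 1) / k\<^sup>2"
  have k: "k > 0" "sin k \<noteq> 0" using assms by (auto simp: k_def)
  have k2: "k\<^sup>2 = p\<^sup>2 + q\<^sup>2" using norm_vec3_sq[of \<theta>] assms(1) by (simp add: k_def p_def q_def)
  define xc where "xc = (\<chi> i. complex_of_real (x $ i))"
  have xc: "xc $ 1 = of_real N" "xc $ 2 = 0" "xc $ 3 = 0"
    by (simp_all add: xc_def x axis_def)
  have sd: "sdivsin (of_real k) = of_real (k / sin k)" "sdivsin (- of_real k) = of_real (k / sin k)"
    "sdivsin 0 = 1"
    using k by (simp_all add: sdivsin_def sin_of_real)
  have "matfun sdivsin (Umat \<theta>) *v xc = xc + of_real c *s (Umat \<theta> *v (Umat \<theta> *v xc))"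
    using matfun_Umat[OF assms(2), of sdivsin xc] sd by (simp add: k_def[symmetric] c_def)
  note this[unfolded vec_eq_iff forall_3]
  then have comp: "(matfun sdivsin (Umat \<theta>) *v xc) $ 1 = of_real (N + c * q\<^sup>2 * N)"
    "(matfun sdivsin (Umat \<theta>) *v xc) $ 2 = of_real (- c * p * q * N)"
    "(matfun sdivsin (Umat \<theta>) *v xc) $ 3 = 0"
    by (simp_all add: Umat_mult_components xc assms(1) p_def q_def power2_eq_square algebra_simps)
  have "(norm (matfun sdivsin (Umat \<theta>) *v xc))\<^sup>2 = (N + c * q\<^sup>2 * N)\<^sup>2 + (- c * p * q * N)\<^sup>2"
    unfolding norm_vec_def L2_set_def
    by (simp add: sum_3 comp del: of_real_add of_real_mult of_real_minus of_real_diff)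
  also have "\<dots> = N\<^sup>2 * (1 + 2 * c * q\<^sup>2 + c\<^sup>2 * q\<^sup>2 * (p\<^sup>2 + q\<^sup>2))"
    by (simp add: power2_eq_square algebra_simps)
  also have "1 + 2 * c * q\<^sup>2 + c\<^sup>2 * q\<^sup>2 * (p\<^sup>2 + q\<^sup>2) = 1 + q\<^sup>2 * (1 / (sin k)\<^sup>2 - 1 / k\<^sup>2)"
    unfolding k2[symmetric] c_def using k by (simp add: power2_eq_square field_simps)
  also have "\<dots> = p\<^sup>2 / k\<^sup>2 + (q / sin k)\<^sup>2"
  proof -
    have "p\<^sup>2 / k\<^sup>2 + q\<^sup>2 / k\<^sup>2 = 1" using k by (simp add: add_divide_distrib[symmetric] k2[symmetric])
    then show ?thesis by (simp add: power_divide algebra_simps)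
  qed
  finally show ?thesis by (simp add: xc_def k_def p_def q_def)
qed

section \<open>The derivative of \<open>psi\<close> and the chain of equalities\<close>

lemma deriv_psi:
  assumes "sin k \<noteq> 0"
  shows "deriv psi k = (k / (sin k)\<^sup>2 - cot k) / k\<^sup>2 - 2 * psi k / k"
proof (rule DERIV_imp_deriv)
  have "k \<noteq> 0" using assms by auto
  have "((\<lambda>s. (1 - s * cot s) / s\<^sup>2) has_real_derivative
      (k / (sin k)\<^sup>2 - cot k) / k\<^sup>2 - 2 * psi k / k) (at k)"
    using assms \<open>k \<noteq> 0\<close>
    by (auto intro!: derivative_eq_intros DERIV_cot[OF assms] simp: psi_def field_simps power2_eq_square)
  \<comment> \<open>The separate value of \<open>psi\<close> at 0 is avoided on a neighbourhood of
    the nonzero point \<open>k\<close>.\<close>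
  moreover have "\<forall>\<^sub>F s in nhds k. (1 - s * cot s) / s\<^sup>2 = psi s"
    using t1_space_nhds[OF \<open>k \<noteq> 0\<close>] by eventually_elim (simp add: psi_def)
  ultimately show "(psi has_real_derivative (k / (sin k)\<^sup>2 - cot k) / k\<^sup>2 - 2 * psi k / k) (at k)"
    using DERIV_cong_ev[of k k "\<lambda>s. (1 - s * cot s) / s\<^sup>2" psi] by simp
qed

theorem theorem11p2:
  fixes x \<theta> t :: "real^3"
  assumes hx: "norm x > 0" "x = norm x *\<^sub>R axis 1 1"
    and h\<theta>: "\<theta> $ 3 = 0" "norm \<theta> < pi" "\<theta> $ 2 > 0"
    and ht: "t = ((norm x)\<^sup>2 / 4 * \<theta> $ 2) *\<^sub>R
               ((deriv psi (norm \<theta>) / norm \<theta> * \<theta> $ 2) *\<^sub>R \<theta>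
                + (2 * psi (norm \<theta>)) *\<^sub>R axis 2 1)"
  shows "(ccdist (x, t))\<^sup>2 = phi (x, t) \<theta>
    \<and> phi (x, t) \<theta> = (norm x)\<^sup>2 * (1 + psi (norm \<theta>) * (\<theta> $ 2)\<^sup>2
                           + deriv psi (norm \<theta>) * norm \<theta> * (\<theta> $ 2)\<^sup>2)
    \<and> (norm x)\<^sup>2 * (1 + psi (norm \<theta>) * (\<theta> $ 2)\<^sup>2
                           + deriv psi (norm \<theta>) * norm \<theta> * (\<theta> $ 2)\<^sup>2)
      = (norm x)\<^sup>2 * ((\<theta> $ 1)\<^sup>2 / (norm \<theta>)\<^sup>2 + (\<theta> $ 2 / sin (norm \<theta>))\<^sup>2)
    \<and> (norm x)\<^sup>2 * ((\<theta> $ 1)\<^sup>2 / (norm \<theta>)\<^sup>2 + (\<theta> $ 2 / sin (norm \<theta>))\<^sup>2)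
      = (norm (matfun sdivsin (Umat \<theta>) *v (\<chi> i. complex_of_real (x $ i))))\<^sup>2"
proof -
  define N k p q where "N = norm x" and "k = norm \<theta>" and "p = \<theta> $ 1" and "q = \<theta> $ 2"
  define A D where "A = psi k" and "D = deriv psi k"
  have "q > 0" "N > 0" using hx h\<theta> by (auto simp: N_def q_def)
  have "\<theta> \<noteq> 0" using h\<theta>(3) by auto
  have k: "k > 0" "k < pi" using \<open>\<theta> \<noteq> 0\<close> h\<theta> by (auto simp: k_def)
  have sk: "sin k > 0" using k by (rule sin_gt_zero)
  then have sk0: "sin k \<noteq> 0" by simp
  have k2: "k\<^sup>2 = p\<^sup>2 + q\<^sup>2" using norm_vec3_sq[of \<theta>] h\<theta>(1) by (simp add: k_def p_def q_def)
  have A: "A = (1 - k * cot k) / k\<^sup>2" using k by (simp add: A_def psi_def)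
  have D: "D = (k / (sin k)\<^sup>2 - cot k) / k\<^sup>2 - 2 * A / k"
    unfolding A_def D_def by (rule deriv_psi[OF sk0])
  have x_comps: "x $ 1 = N" "x $ 2 = 0" "x $ 3 = 0"
    using arg_cong[OF hx(2), of "\<lambda>x. x $ 1"] arg_cong[OF hx(2), of "\<lambda>x. x $ 2"]
      arg_cong[OF hx(2), of "\<lambda>x. x $ 3"] by (simp_all add: axis_def N_def)
  have t_comps: "t $ 1 = N\<^sup>2 / 4 * q * (D / k * q * p)" "t $ 2 = N\<^sup>2 / 4 * q * (D / k * q * q + 2 * A)"
    "t $ 3 = 0"
    unfolding ht using h\<theta>(1) by (simp_all add: axis_def N_def k_def p_def q_def A_def D_def)
  have phi_eq: "phi (x, t) \<theta> = N\<^sup>2 * (1 + A * q\<^sup>2 + D * k * q\<^sup>2)"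
  proof -
    have "\<theta> \<bullet> x = N * p"
      using x_comps by (simp add: inner_vec_def sum_3 p_def)
    moreover have "t \<bullet> \<theta> = N\<^sup>2 / 4 * (D / k * q\<^sup>2 * (p\<^sup>2 + q\<^sup>2) + 2 * A * q\<^sup>2)"
    proof -
      have "t \<bullet> \<theta> = t $ 1 * p + t $ 2 * q"
        using h\<theta>(1) by (simp add: inner_vec_def sum_3 p_def q_def)
      then show ?thesis
        unfolding t_comps using k by (simp add: power2_eq_square field_simps)
    qed
    moreover have "scot k = 1 - A * k\<^sup>2" using k by (simp add: A scot_def)
    ultimately have "phi (x, t) \<theta> = N\<^sup>2 * (1 - A * k\<^sup>2) + A * (N * p)\<^sup>2
        + 4 * (N\<^sup>2 / 4 * (D / k * q\<^sup>2 * k\<^sup>2 + 2 * A * q\<^sup>2))"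
      by (simp add: phi_def k_def[symmetric] N_def[symmetric] A_def[symmetric] k2[symmetric])
    also have "D / k * q\<^sup>2 * k\<^sup>2 = D * k * q\<^sup>2" using k by (simp add: power2_eq_square)
    finally show ?thesis unfolding k2 by (simp add: power2_eq_square algebra_simps)
  qed
  have val_eq: "N\<^sup>2 * (1 + A * q\<^sup>2 + D * k * q\<^sup>2) = N\<^sup>2 * (p\<^sup>2 / k\<^sup>2 + (q / sin k)\<^sup>2)"
  proof -
    \<comment> \<open>In this combination the cotangent terms cancel, which is why the value has a
      closed form in the sine alone.\<close>
    have "A + D * k = 1 / (sin k)\<^sup>2 - 1 / k\<^sup>2"
      unfolding D A using k sk by (simp add: field_simps power2_eq_square)
    then have "1 + A * q\<^sup>2 + D * k * q\<^sup>2 = 1 + (1 / (sin k)\<^sup>2 - 1 / k\<^sup>2) * q\<^sup>2"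
      by (metis add.assoc distrib_right)
    also have "\<dots> = p\<^sup>2 / k\<^sup>2 + (q / sin k)\<^sup>2"
    proof -
      have "p\<^sup>2 / k\<^sup>2 + q\<^sup>2 / k\<^sup>2 = 1" using k by (simp add: add_divide_distrib[symmetric] k2[symmetric])
      then show ?thesis by (simp add: power_divide algebra_simps)
    qed
    finally show ?thesis by simp
  qed
  \<comment> \<open>In the frame whose first vector is \<open>\<theta>\<close> divided by
    \<open>k\<close>, the vector \<open>x\<close> has coordinates \<open>N * p / k\<close>,
    \<open>N * q / k\<close> and 0. The first is the advance \<open>b\<close>, the second must be
    the chord \<open>2 * R * sin k\<close>.\<close>
  define b R where "b = N * p / k" and "R = N * q / k / (2 * sin k)"
  define V where "V = sqrt (b\<^sup>2 + (2 * k * R)\<^sup>2)"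
  have V2: "V\<^sup>2 = N\<^sup>2 * (p\<^sup>2 / k\<^sup>2 + (q / sin k)\<^sup>2)"
    using k sk by (simp add: V_def b_def R_def power_divide power_mult_distrib distrib_left)
  have cd: "(p / k)\<^sup>2 + (q / k)\<^sup>2 = 1"
    using k by (simp add: power_divide add_divide_distrib[symmetric] k2[symmetric])
  have end_x: "frame (p / k) (q / k) b (2 * R * sin k) 0 = x"
  proof -
    have "2 * R * sin k = N * (q / k)" "b = N * (p / k)" using sk by (simp_all add: R_def b_def)
    moreover have "p / k * (N * (p / k)) + q / k * (N * (q / k)) = N * ((p / k)\<^sup>2 + (q / k)\<^sup>2)"
      by (simp add: power2_eq_square algebra_simps)
    ultimately show ?thesis using cd x_comps by (simp add: vec_eq_iff forall_3)
  qed
  have end_t: "frame (p / k) (q / k) (R\<^sup>2 * (k - sin k * cos k)) (R * b * (cos k - sin k / k)) 0 = t"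
  proof -
    \<comment> \<open>The frame coordinates of the vertical endpoint are expressed by
      \<open>psi\<close> and its derivative; adding \<open>2 * A / k\<close> cancels the last term
      of \<open>D\<close> and leaves the quotient that the circular segment produces.\<close>
    have te: "R\<^sup>2 * (k - sin k * cos k) = N\<^sup>2 * q\<^sup>2 / 4 * (D + 2 * A / k)"
      unfolding D R_def cot_def using k sk by (simp add: field_simps power2_eq_square)
    have tf: "R * b * (cos k - sin k / k) = - (N\<^sup>2 * q * p * A / (2 * k))"
      unfolding A R_def b_def cot_def using k sk by (simp add: field_simps power2_eq_square)
    have c1: "p / k * (N\<^sup>2 * q\<^sup>2 / 4 * (D + 2 * A / k)) + q / k * - (N\<^sup>2 * q * p * A / (2 * k)) = t $ 1"
      unfolding t_comps using k by (simp add: field_simps power2_eq_square)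
    have "q / k * (N\<^sup>2 * q\<^sup>2 / 4 * (D + 2 * A / k)) - p / k * - (N\<^sup>2 * q * p * A / (2 * k))
        = N\<^sup>2 / 4 * q * (D / k * q * q + 2 * A * ((p / k)\<^sup>2 + (q / k)\<^sup>2))"
      using k by (simp add: field_simps power2_eq_square)
    also have "\<dots> = t $ 2" unfolding cd t_comps by simp
    finally show ?thesis
      unfolding te tf using c1 t_comps(3) by (simp only: vec_eq_iff forall_3 frame_components simp_thms)
  qed
  obtain \<gamma> where \<gamma>: "horizontal_curve \<gamma> (x, t)" "horiz_length \<gamma> = V"
    using helix_horizontal_curve[OF cd, of k b R] k unfolding end_x end_t V_def by auto
  have phi_V: "phi (x, t) \<theta> = V\<^sup>2" using phi_eq val_eq V2 by simp
  have "ccdist (x, t) = V"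
    unfolding ccdist_def
  \<comment> \<open>The infimum is attained by the helix. The lower bound compares squares, so
    nonnegativity of the length of the competitor is needed to take roots.\<close>
  proof (rule cInf_eq_minimum)
    show "V \<in> {horiz_length \<gamma> | \<gamma>. horizontal_curve \<gamma> (x, t)}" using \<gamma> by blast
    fix l assume "l \<in> {horiz_length \<gamma> | \<gamma>. horizontal_curve \<gamma> (x, t)}"
    then obtain \<eta> where \<eta>: "horizontal_curve \<eta> (x, t)" "l = horiz_length \<eta>" by blast
    have "V\<^sup>2 \<le> l\<^sup>2"
      using phi_le_horiz_length_sq[OF \<eta>(1) \<open>\<theta> \<noteq> 0\<close> h\<theta>(2)] \<eta>(2) phi_V by simp
    moreover have "l \<ge> 0"
      unfolding \<eta>(2) horiz_length_def set_lebesgue_integral_def by (intro integral_nonneg_AE) simp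
    ultimately show "V \<le> l" by (rule power2_le_imp_le)
  qed
  then have "(ccdist (x, t))\<^sup>2 = phi (x, t) \<theta>" using phi_V by simp
  moreover have "sin (norm \<theta>) \<noteq> 0" using sk0 by (simp add: k_def)
  note norm_matfun_sdivsin_Umat[OF h\<theta>(1) \<open>\<theta> \<noteq> 0\<close> this hx(2), symmetric]
  ultimately show ?thesis
    using phi_eq val_eq unfolding A_def D_def N_def k_def p_def q_def by blast
qed

end
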